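(* Let $G$ be a finite simple graph on $[n]=\{1,\dots,n\}$, let $e=\{u,v\}\in E(G)$ be a cut-edge of $G$ such that $v$ is a free vertex in $G\setminus e$, and let $f_e=x_uy_v-x_vy_u$. Then (1) $J_G=J_{G\setminus e}+\langle f_e\rangle$ is a complete Betti splitting, and (2) $\beta_{i,j}(J_G)=\beta_{i,j}(J_{G\setminus e})+\beta_{i-1,j-2}(J_{(G\setminus e)_e})$ for all $i\geq 1$ and $j\geq 0$.
   Context: Let $k$ be a field and $R=k[x_1,\ldots,x_n,y_1,\ldots,y_n]$ with the standard $\mathbb{N}$-grading. For a graph $H$ with $V(H)\subseteq [n]$, its binomial edge ideal is $J_H=\langle x_iy_j-x_jy_i \mid \{i,j\}\in E(H)\rangle\subseteq R$. $G\setminus e$ is the graph with vertex set $V(G)$ and edge set $E(G)\setminus\{e\}$. An edge $e$ is a cut-edge if $G\setminus e$ has more connected components than $G$. A vertex is free in a graph if it belongs to a unique maximal clique, equivalently if its neighbours induce a complete graph. For a graph $H$ and a pair $e=\{i,j\}\notin E(H)$ of distinct vertices, $H_e$ is the graph on $V(H)$ with edge set $E(H)\cup\{\{p,q\}\mid p\neq q,\ p,q\in N_H(i)\text{ or }p,q\in N_H(j)\}$, where $N_H(i)$ is the set of neighbours of $i$ in $H$. Graded Betti numbers are $\beta_{i,j}(L)=\dim_k\mathrm{Tor}_i(k,L)_j$, with $\beta_{i,j}(L)=0$ if $i<0$. If $I=J+K$ are homogeneous ideals such that a minimal homogeneous generating set of $I$ is the disjoint union of minimal homogeneous generating sets of $J$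 and $K$, then $I=J+K$ is a complete Betti splitting if $\beta_{i,j}(I)=\beta_{i,j}(J)+\beta_{i,j}(K)+\beta_{i-1,j}(J\cap K)$ for all $i,j\geq 0$. *)

theory Defs
  imports
    "HOL-Library.Poly_Mapping"
    "HOL-Library.Function_Algebras"
    Complex_Main
begin

section \<open>Graphs\<close>

text \<open>
  A graph is given by its set of edges; its vertex set is the whole finite type \<open>'n\<close>,
  which plays the role of \<open>[n]\<close> with \<open>n = CARD('n)\<close>.
\<close>

definition simple_graph :: "'n set set \<Rightarrow> bool" where
  "simple_graph E \<longleftrightarrow> (\<forall>e\<in>E. card e = 2)"

definition neighbours :: "'n set set \<Rightarrow> 'n \<Rightarrow> 'n set" where
  "neighbours E i = {j. {i, j} \<in> E}"

definition connected_components :: "'n set set \<Rightarrow> 'n set set" where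
  "connected_components E = UNIV // ({(i, j). {i, j} \<in> E}\<^sup>*)"

definition delete_edge :: "'n set set \<Rightarrow> 'n set \<Rightarrow> 'n set set" where
  "delete_edge E e = E - {e}"

definition cut_edge :: "'n set set \<Rightarrow> 'n set \<Rightarrow> bool" where
  "cut_edge E e \<longleftrightarrow>
     e \<in> E \<and> card (connected_components (delete_edge E e)) > card (connected_components E)"

definition clique :: "'n set set \<Rightarrow> 'n set \<Rightarrow> bool" where
  "clique E C \<longleftrightarrow> (\<forall>i\<in>C. \<forall>j\<in>C. i \<noteq> j \<longrightarrow> {i, j} \<in> E)"

definition maximal_clique :: "'n set set \<Rightarrow> 'n set \<Rightarrow> bool" where
  "maximal_clique E C \<longleftrightarrow> clique E C \<and> (\<forall>D. clique E D \<and> C \<subseteq> D \<longrightarrow> D = C)"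

definition free_vertex :: "'n set set \<Rightarrow> 'n \<Rightarrow> bool" where
  "free_vertex E v \<longleftrightarrow> (\<exists>!C. maximal_clique E C \<and> v \<in> C)"

text \<open>The graph \<open>H\<^sub>e\<close> for the non-edge \<open>e = {i, j}\<close>.\<close>

definition edge_completion :: "'n set set \<Rightarrow> 'n \<Rightarrow> 'n \<Rightarrow> 'n set set" where
  "edge_completion E i j =
     E \<union> {{p, q} | p q. p \<noteq> q \<and>
            (p \<in> neighbours E i \<and> q \<in> neighbours E i \<or>
             p \<in> neighbours E j \<and> q \<in> neighbours E j)}"


section \<open>Standard graded polynomial rings\<close>

text \<open>
  Polynomials over \<open>'k\<close> in the variables \<open>'v\<close>: finitely supported maps from monomials
  (exponent vectors) to coefficients, with the convolution product of
  \<^theory>\<open>HOL-Library.Poly_Mapping\<close>.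
\<close>

type_synonym ('v, 'k) mpoly = "('v \<Rightarrow>\<^sub>0 nat) \<Rightarrow>\<^sub>0 'k"

definition Var :: "'v \<Rightarrow> ('v, 'k::comm_ring_1) mpoly" where
  "Var v = Poly_Mapping.single (Poly_Mapping.single v 1) 1"

definition mon_degree :: "('v \<Rightarrow>\<^sub>0 nat) \<Rightarrow> nat" where
  "mon_degree m = (\<Sum>v\<in>Poly_Mapping.keys m. Poly_Mapping.lookup m v)"

text \<open>The graded piece of degree \<open>d\<close>; it is \<open>{0}\<close> for negative \<open>d\<close>.\<close>

definition graded_piece :: "int \<Rightarrow> ('v, 'k::comm_ring_1) mpoly set" where
  "graded_piece d = {p. \<forall>m\<in>Poly_Mapping.keys p. int (mon_degree m) = d}"

definition homogeneous :: "('v, 'k::comm_ring_1) mpoly \<Rightarrow> bool" where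
  "homogeneous p \<longleftrightarrow> (\<exists>d. p \<in> graded_piece d)"

definition ideal_gen :: "('v, 'k::comm_ring_1) mpoly set \<Rightarrow> ('v, 'k) mpoly set" where
  "ideal_gen S = module.span (*) S"

definition ideal_sum ::
  "('v, 'k::comm_ring_1) mpoly set \<Rightarrow> ('v, 'k) mpoly set \<Rightarrow> ('v, 'k) mpoly set" where
  "ideal_sum J K = {a + b | a b. a \<in> J \<and> b \<in> K}"

definition homogeneous_ideal :: "('v, 'k::comm_ring_1) mpoly set \<Rightarrow> bool" where
  "homogeneous_ideal I \<longleftrightarrow> (\<exists>S. (\<forall>s\<in>S. homogeneous s) \<and> I = ideal_gen S)"

definition minimal_homogeneous_generators ::
  "('v, 'k::comm_ring_1) mpoly set \<Rightarrow> ('v, 'k) mpoly set \<Rightarrow> bool" where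
  "minimal_homogeneous_generators A I \<longleftrightarrow>
     (\<forall>a\<in>A. homogeneous a) \<and> ideal_gen A = I \<and> (\<forall>B. B \<subset> A \<longrightarrow> ideal_gen B \<noteq> I)"

lemma module_mpoly: "module ((*) :: ('v, 'k::comm_ring_1) mpoly \<Rightarrow> _)"
  by unfold_locales (simp_all add: algebra_simps)


section \<open>Graded free resolutions of the residue field\<close>

text \<open>
  A complex \<open>\<dots> \<rightarrow> P\<^sub>1 \<rightarrow> P\<^sub>0 \<rightarrow> k\<close>, where \<open>P\<^sub>i\<close> is the direct sum of the \<open>R(-res_shift i a)\<close> over
  \<open>a < res_rank i\<close>. The map \<open>P\<^sub>i\<^sub>+\<^sub>1 \<rightarrow> P\<^sub>i\<close> has the matrix \<open>res_diff i\<close> (entry \<open>res_diff i a b\<close> in row \<open>a\<close>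
  and column \<open>b\<close>), and the augmentation \<open>P\<^sub>0 \<rightarrow> k = R/\<mm>\<close> sends the \<open>a\<close>-th basis element to \<open>res_aug a\<close>.
  Elements of \<open>P\<^sub>i\<close> are functions \<open>nat \<Rightarrow> R\<close> vanishing outside \<open>{..<res_rank i}\<close>.
\<close>

record (overloaded) ('v, 'k) free_complex =
  res_rank :: "nat \<Rightarrow> nat"
  res_shift :: "nat \<Rightarrow> nat \<Rightarrow> int"
  res_diff :: "nat \<Rightarrow> nat \<Rightarrow> nat \<Rightarrow> (('v \<Rightarrow>\<^sub>0 nat) \<Rightarrow>\<^sub>0 'k)"
  res_aug :: "nat \<Rightarrow> 'k"

definition free_module ::
  "('v, 'k::field) free_complex \<Rightarrow> nat \<Rightarrow> (nat \<Rightarrow> ('v, 'k) mpoly) set" where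
  "free_module P i = {w. \<forall>a\<ge>res_rank P i. w a = 0}"

definition diff_map ::
  "('v, 'k::field) free_complex \<Rightarrow> nat \<Rightarrow> (nat \<Rightarrow> ('v, 'k) mpoly) \<Rightarrow> nat \<Rightarrow> ('v, 'k) mpoly" where
  "diff_map P i w =
     (\<lambda>a. if a < res_rank P i then \<Sum>b<res_rank P (Suc i). res_diff P i a b * w b else 0)"

text \<open>\<open>R\<close> acts on \<open>k\<close> through the constant coefficient.\<close>

definition aug_map :: "('v, 'k::field) free_complex \<Rightarrow> (nat \<Rightarrow> ('v, 'k) mpoly) \<Rightarrow> 'k" where
  "aug_map P w = (\<Sum>a<res_rank P 0. res_aug P a * Poly_Mapping.lookup (w a) 0)"

text \<open>
  The first two conditions say that the maps are homogeneous of degree \<open>0\<close> (with \<open>k\<close>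
  concentrated in degree \<open>0\<close>), the others that the augmented complex is exact.
\<close>

definition graded_free_resolution :: "('v, 'k::field) free_complex \<Rightarrow> bool" where
  "graded_free_resolution P \<longleftrightarrow>
     (\<forall>i. \<forall>a<res_rank P i. \<forall>b<res_rank P (Suc i).
        res_diff P i a b \<in> graded_piece (res_shift P (Suc i) b - res_shift P i a)) \<and>
     (\<forall>a<res_rank P 0. res_aug P a \<noteq> 0 \<longrightarrow> res_shift P 0 a = 0) \<and>
     aug_map P ` free_module P 0 = UNIV \<and>
     {w \<in> free_module P 0. aug_map P w = 0} = diff_map P 0 ` free_module P 1 \<and>
     (\<forall>i. {w \<in> free_module P (Suc i). diff_map P i w = 0}
            = diff_map P (Suc i) ` free_module P (Suc (Suc i)))"


section \<open>Tor and graded Betti numbers\<close>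

text \<open>
  \<open>Tor\<^sub>i(k, L)\<close> is the homology of \<open>P \<otimes> L\<close> for a graded free resolution \<open>P\<close> of \<open>k\<close>.
  As \<open>P\<^sub>i\<close> is free, \<open>P\<^sub>i \<otimes> L\<close> is the direct sum of the \<open>L(-res_shift i a)\<close>, with differential
  given by the same matrices. \<open>tor_chains P L i j\<close> is its piece of degree \<open>j\<close>.
\<close>

definition tor_chains ::
  "('v, 'k::field) free_complex \<Rightarrow> ('v, 'k) mpoly set \<Rightarrow> nat \<Rightarrow> int \<Rightarrow> (nat \<Rightarrow> ('v, 'k) mpoly) set"
where
  "tor_chains P L i j =
     {w \<in> free_module P i. \<forall>a<res_rank P i. w a \<in> L \<inter> graded_piece (j - res_shift P i a)}"

definition tor_cycles ::
  "('v, 'k::field) free_complex \<Rightarrow> ('v, 'k) mpoly set \<Rightarrow> nat \<Rightarrow> int \<Rightarrow> (nat \<Rightarrow> ('v, 'k) mpoly) set"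
where
  "tor_cycles P L i j =
     {w \<in> tor_chains P L i j. i = 0 \<or> diff_map P (i - 1) w = 0}"

definition tor_boundaries ::
  "('v, 'k::field) free_complex \<Rightarrow> ('v, 'k) mpoly set \<Rightarrow> nat \<Rightarrow> int \<Rightarrow> (nat \<Rightarrow> ('v, 'k) mpoly) set"
where
  "tor_boundaries P L i j = diff_map P i ` tor_chains P L (Suc i) j"

definition kscale ::
  "'k::field \<Rightarrow> (nat \<Rightarrow> ('v, 'k) mpoly) \<Rightarrow> nat \<Rightarrow> ('v, 'k) mpoly" where
  "kscale c w = (\<lambda>a. Poly_Mapping.single 0 c * w a)"

lemma vector_space_kscale:
  "vector_space (kscale :: 'k::field \<Rightarrow> (nat \<Rightarrow> ('v, 'k) mpoly) \<Rightarrow> _)"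
  by unfold_locales
    (simp_all add: kscale_def fun_eq_iff algebra_simps single_add mult_single
      mult.assoc [symmetric])

text \<open>
  The chain spaces are finite-dimensional (finite ranks, finitely many variables), so the
  difference below is the dimension of the quotient space of cycles modulo boundaries.
\<close>

definition tor_dim ::
  "('v, 'k::field) free_complex \<Rightarrow> ('v, 'k) mpoly set \<Rightarrow> nat \<Rightarrow> int \<Rightarrow> nat" where
  "tor_dim P L i j =
     vector_space.dim kscale (tor_cycles P L i j) -
     vector_space.dim kscale (tor_boundaries P L i j)"

text \<open>Tor does not depend on the resolution, so an arbitrary one is chosen.\<close>

definition residue_field_resolution :: "('v::finite, 'k::field) free_complex" where
  "residue_field_resolution = (SOME P. graded_free_resolution P)"

definition betti :: "int \<Rightarrow> int \<Rightarrow> ('v::finite, 'k::field) mpoly set \<Rightarrow> nat" where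
  "betti i j L = (if i < 0 then 0 else tor_dim residue_field_resolution L (nat i) j)"

definition complete_betti_splitting ::
  "('v::finite, 'k::field) mpoly set \<Rightarrow> ('v, 'k) mpoly set \<Rightarrow> ('v, 'k) mpoly set \<Rightarrow> bool" where
  "complete_betti_splitting I J K \<longleftrightarrow>
     homogeneous_ideal I \<and> homogeneous_ideal J \<and> homogeneous_ideal K \<and>
     I = ideal_sum J K \<and>
     (\<exists>A B. minimal_homogeneous_generators A J \<and> minimal_homogeneous_generators B K \<and>
            A \<inter> B = {} \<and> minimal_homogeneous_generators (A \<union> B) I) \<and>
     (\<forall>i\<ge>0. \<forall>j\<ge>0. betti i j I = betti i j J + betti i j K + betti (i - 1) j (J \<inter> K))"


section \<open>Binomial edge ideals\<close>

text \<open>The variables \<open>x\<^sub>i\<close> and \<open>y\<^sub>i\<close> are indexed by \<open>Inl i\<close> and \<open>Inr i\<close>.\<close>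

definition edge_binomial :: "'n \<Rightarrow> 'n \<Rightarrow> ('n + 'n, 'k::field) mpoly" where
  "edge_binomial i j = Var (Inl i) * Var (Inr j) - Var (Inl j) * Var (Inr i)"

definition binomial_edge_ideal :: "'n set set \<Rightarrow> ('n + 'n, 'k::field) mpoly set" where
  "binomial_edge_ideal E = ideal_gen {edge_binomial i j | i j. {i, j} \<in> E}"

end

theory Submission
  imports Defs
begin

text \<open>
  Let \<open>J\<close> be the ideal of \<open>G \ e\<close>, \<open>K = \<langle>f\<rangle>\<close> with \<open>f = f\<^sub>e\<close>, and \<open>H\<close> the ideal of \<open>(G \ e)\<^sub>e\<close>. Both \<open>u\<close> and \<open>v\<close> have a
  clique as neighbourhood in \<open>(G \ e)\<^sub>e\<close>, and by induction on the number of vertices without this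
  property (Ohtani's decomposition) their variables are nonzerodivisors modulo \<open>H\<close>. As \<open>u\<close> and \<open>v\<close> lie in
  different components, comparing parts of top degree in the variables \<open>x\<^sub>i\<close> with \<open>i\<close> in the component
  of \<open>v\<close> shows that \<open>f\<close> is a nonzerodivisor modulo \<open>H\<close> as well, whence \<open>J \<inter> K = f H\<close>.

  Since \<open>x\<^sub>u\<close> and \<open>y\<^sub>u\<close> multiply \<open>H\<close> into \<open>J\<close> and \<open>f = y\<^sub>v x\<^sub>u - x\<^sub>v y\<^sub>u\<close>, the map of Tor induced by
  \<open>J \<inter> K \<subseteq> J\<close> is a combination of multiplications by \<open>y\<^sub>v\<close> and \<open>x\<^sub>v\<close>, which are zero on \<open>Tor(k, J)\<close>. The map
  induced by \<open>J \<inter> K \<subseteq> K\<close> is zero because \<open>K\<close> is free and \<open>H\<close> has no constant terms. So the cycles with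
  coefficients in \<open>J \<inter> K\<close> are exactly the common boundaries of \<open>J\<close> and \<open>K\<close>, and counting dimensions
  of chains, cycles and boundaries gives the splitting.
\<close>

section \<open>Restricting polynomials to sets of monomials\<close>

lemma poly_mapping_expand:
  "p = (\<Sum>m\<in>Poly_Mapping.keys p. Poly_Mapping.single m (Poly_Mapping.lookup p m))"
  for p :: "'m \<Rightarrow>\<^sub>0 'k::comm_monoid_add"
proof (rule poly_mapping_eqI)
  fix k
  show "Poly_Mapping.lookup p k = Poly_Mapping.lookup
      (\<Sum>m\<in>Poly_Mapping.keys p. Poly_Mapping.single m (Poly_Mapping.lookup p m)) k"
    by (simp add: lookup_sum lookup_single when_def in_keys_iff)
qed

lemma poly_mapping_add_induct [case_names zero single add]:
  fixes p :: "'m \<Rightarrow>\<^sub>0 'k::comm_monoid_add"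
  assumes "P 0" and "\<And>m c. P (Poly_Mapping.single m c)" and "\<And>p q. P p \<Longrightarrow> P q \<Longrightarrow> P (p + q)"
  shows "P p"
proof -
  have "P (\<Sum>m\<in>A. Poly_Mapping.single m (Poly_Mapping.lookup p m))" if "finite A" for A
    using that by induction (auto intro: assms)
  from this[of "Poly_Mapping.keys p"] show ?thesis
    by (simp flip: poly_mapping_expand)
qed

text \<open>Used for homogeneous components of a grading, for setting variables to zero, and for
  splitting off the monomials that involve given variables.\<close>

definition restr :: "('m \<Rightarrow> bool) \<Rightarrow> ('m \<Rightarrow>\<^sub>0 'k::zero) \<Rightarrow> 'm \<Rightarrow>\<^sub>0 'k" where
  "restr P p = Poly_Mapping.mapp (\<lambda>m c. if P m then c else 0) p"

lemma lookup_restr: "Poly_Mapping.lookup (restr P p) m = (if P m then Poly_Mapping.lookup p m else 0)"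
  by (simp add: restr_def lookup_mapp when_def in_keys_iff)

lemma keys_restr: "Poly_Mapping.keys (restr P p) = {m \<in> Poly_Mapping.keys p. P m}"
  by (auto simp: in_keys_iff lookup_restr split: if_splits)

lemma restr_zero [simp]: "restr P 0 = 0"
  by (rule poly_mapping_eqI) (simp add: lookup_restr)

lemma restr_add: "restr P (p + q) = restr P p + restr P q" for p q :: "'m \<Rightarrow>\<^sub>0 'k::monoid_add"
  by (rule poly_mapping_eqI) (simp add: lookup_restr lookup_add)

lemma restr_diff: "restr P (p - q) = restr P p - restr P q" for p q :: "'m \<Rightarrow>\<^sub>0 'k::ab_group_add"
  by (rule poly_mapping_eqI) (simp add: lookup_restr lookup_minus)

lemma restr_sum: "restr P (sum f A) = (\<Sum>a\<in>A. restr P (f a))"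
  for f :: "'a \<Rightarrow> 'm \<Rightarrow>\<^sub>0 'k::comm_monoid_add"
  by (induction A rule: infinite_finite_induct) (simp_all add: restr_add)

lemma restr_single: "restr P (Poly_Mapping.single m c) = (if P m then Poly_Mapping.single m c else 0)"
  by (rule poly_mapping_eqI) (simp add: lookup_restr lookup_single when_def)

lemma restr_eq_self: "(\<And>m. m \<in> Poly_Mapping.keys p \<Longrightarrow> P m) \<Longrightarrow> restr P p = p"
  by (rule poly_mapping_eqI) (auto simp add: lookup_restr in_keys_iff)

lemma restr_eq_zero: "(\<And>m. m \<in> Poly_Mapping.keys p \<Longrightarrow> \<not> P m) \<Longrightarrow> restr P p = 0"
  by (rule poly_mapping_eqI) (auto simp add: lookup_restr in_keys_iff)

text \<open>The hypothesis makes every monomial of \<open>q\<close> translate \<open>Q\<close> into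
  \<open>P\<close> in the same way. For a grading and homogeneous \<open>q\<close>, this is the
  shift of degrees by the degree of \<open>q\<close>.\<close>

lemma restr_mult_homogeneous:
  fixes p q :: "'m::monoid_add \<Rightarrow>\<^sub>0 'k::comm_ring_1"
  assumes "\<And>m m'. m \<in> Poly_Mapping.keys q \<Longrightarrow> P (m + m') \<longleftrightarrow> Q m'"
  shows "restr P (q * p) = q * restr Q p"
proof -
  have 1: "restr P (Poly_Mapping.single m c * p) = Poly_Mapping.single m c * restr Q p"
    if "m \<in> Poly_Mapping.keys q" for m c
  proof (induction p rule: poly_mapping_add_induct)
    case (single m' c')
    show ?case using assms[OF that, of m'] by (simp add: mult_single restr_single)
  qed (simp_all add: restr_add algebra_simps)
  have "restr P (q * p) = restr P (\<Sum>m\<in>Poly_Mapping.keys q.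
      Poly_Mapping.single m (Poly_Mapping.lookup q m) * p)"
    by (subst poly_mapping_expand[of q]) (simp add: sum_distrib_right)
  also have "\<dots> = (\<Sum>m\<in>Poly_Mapping.keys q.
      Poly_Mapping.single m (Poly_Mapping.lookup q m) * restr Q p)"
    by (simp add: restr_sum 1)
  also have "\<dots> = q * restr Q p"
    by (subst (3) poly_mapping_expand[of q]) (simp add: sum_distrib_right)
  finally show ?thesis .
qed

text \<open>By hypothesis the monomials outside \<open>P\<close> span an ideal, and
  \<open>restr P\<close> is reduction modulo that ideal.\<close>

lemma restr_mult:
  fixes p q :: "'m::monoid_add \<Rightarrow>\<^sub>0 'k::comm_ring_1"
  assumes "\<And>m m'. P (m + m') \<longleftrightarrow> P m \<and> P m'"
  shows "restr P (p * q) = restr P p * restr P q"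
proof (induction p rule: poly_mapping_add_induct)
  case (single m c)
  show ?case
  proof (induction q rule: poly_mapping_add_induct)
    case (single m' c')
    show ?case by (simp add: mult_single restr_single assms)
  qed (simp_all add: restr_add algebra_simps)
qed (simp_all add: restr_add algebra_simps)

section \<open>Ideals\<close>

interpretation ideal: module "(*) :: ('v, 'k::comm_ring_1) mpoly \<Rightarrow> _"
  by (rule module_mpoly)

text \<open>Being \<open>mult.assoc\<close> reversed, this rule would make the simplifier loop.\<close>

declare ideal.scale_scale [simp del]

lemma ideal_gen_subspace [simp]: "ideal.subspace (ideal_gen S)"
  by (simp add: ideal_gen_def)

lemma ideal_gen_base: "s \<in> S \<Longrightarrow> s \<in> ideal_gen S"
  by (simp add: ideal_gen_def ideal.span_base)

lemma ideal_gen_minimal: "S \<subseteq> L \<Longrightarrow> ideal.subspace L \<Longrightarrow> ideal_gen S \<subseteq> L"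
  unfolding ideal_gen_def by (rule ideal.span_minimal)

lemma ideal_gen_induct [consumes 1, case_names zero step]:
  assumes "p \<in> ideal_gen S" and "P 0"
    and "\<And>c s q. s \<in> S \<Longrightarrow> q \<in> ideal_gen S \<Longrightarrow> P q \<Longrightarrow> P (c * s + q)"
  shows "P p"
proof -
  have "p \<in> ideal_gen S \<and> P p"
    using assms(1) unfolding ideal_gen_def
    by (induction rule: ideal.span_induct_alt)
      (use assms in \<open>auto simp: ideal_gen_def ideal.span_zero ideal.span_add ideal.span_scale ideal.span_base\<close>)
  then show ?thesis ..
qed

lemma ideal_gen_singleton: "ideal_gen {f} = {p * f | p. True}"
proof
  show "ideal_gen {f} \<subseteq> {p * f | p. True}"
  proof
    fix q assume "q \<in> ideal_gen {f}"
    then show "q \<in> {p * f | p. True}"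
    proof (induction rule: ideal_gen_induct)
      case zero
      show ?case by (auto intro: exI[of _ 0])
    next
      case (step c s q)
      then obtain r where "q = r * f" by auto
      with step have "c * s + q = (c + r) * f" by (simp add: algebra_simps)
      then show ?case by blast
    qed
  qed
qed (auto intro: ideal.subspace_scale ideal_gen_base)

text \<open>Only the component of degree \<open>d - h\<close> of a coefficient contributes to degree
  \<open>d\<close> when the generator has degree \<open>h\<close>. The grading is a parameter
  because both the total degree and a degree counting only some variables are used.\<close>

lemma restr_in_ideal_gen:
  fixes \<kappa> :: "('v \<Rightarrow>\<^sub>0 nat) \<Rightarrow> 'g::ab_group_add"
  assumes add: "\<And>m m'. \<kappa> (m + m') = \<kappa> m + \<kappa> m'"
    and hom: "\<And>s. s \<in> S \<Longrightarrow> \<exists>h. \<forall>m\<in>Poly_Mapping.keys s. \<kappa> m = h"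
    and p: "p \<in> ideal_gen S"
  shows "restr (\<lambda>m. \<kappa> m = d) p \<in> ideal_gen S"
  using p
proof (induction rule: ideal_gen_induct)
  case zero
  then show ?case using ideal.subspace_0[OF ideal_gen_subspace] by simp
next
  case (step c s q)
  from hom[OF step(1)] obtain h where h: "\<forall>m\<in>Poly_Mapping.keys s. \<kappa> m = h" by blast
  have "restr (\<lambda>m. \<kappa> m = d) (s * c) = s * restr (\<lambda>m. \<kappa> m = d - h) c"
    by (rule restr_mult_homogeneous) (use h in \<open>auto simp: add eq_diff_eq add.commute\<close>)
  then have "restr (\<lambda>m. \<kappa> m = d) (c * s + q) = restr (\<lambda>m. \<kappa> m = d - h) c * s + restr (\<lambda>m. \<kappa> m = d) q"
    by (simp add: restr_add mult.commute)
  moreover have "restr (\<lambda>m. \<kappa> m = d - h) c * s + restr (\<lambda>m. \<kappa> m = d) q \<in> ideal_gen S"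
    by (intro ideal.subspace_add[OF ideal_gen_subspace] ideal.subspace_scale[OF ideal_gen_subspace]
        ideal_gen_base step)
  ultimately show ?case by metis
qed

lemma single_conv_Var_mult:
  assumes "Poly_Mapping.lookup m t > 0"
  shows "\<exists>m'. m = m' + Poly_Mapping.single t 1 \<and>
    Poly_Mapping.single m c = Poly_Mapping.single m' c * Var t"
proof -
  define m' where "m' = m - Poly_Mapping.single t 1"
  have "m = m' + Poly_Mapping.single t 1"
    unfolding m'_def using assms
    by (intro poly_mapping_eqI) (auto simp: lookup_add lookup_minus lookup_single when_def)
  then show ?thesis
    by (intro exI[of _ m']) (simp add: Var_def mult_single)
qed

text \<open>Each monomial of \<open>b\<close> is a multiple of a variable in \<open>T\<close>, so
  \<open>b\<close> lies in the ideal generated by these variables.\<close>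

lemma mult_mem_of_vars:
  fixes b f :: "('v, 'k::comm_ring_1) mpoly"
  assumes L: "ideal.subspace L"
    and b: "\<And>m. m \<in> Poly_Mapping.keys b \<Longrightarrow> \<exists>t\<in>T. Poly_Mapping.lookup m t > 0"
    and f: "\<And>t. t \<in> T \<Longrightarrow> Var t * f \<in> L"
  shows "b * f \<in> L"
proof -
  have "Poly_Mapping.single m (Poly_Mapping.lookup b m) * f \<in> L" if m: "m \<in> Poly_Mapping.keys b" for m
  proof -
    from b[OF m] obtain t where t: "t \<in> T" "Poly_Mapping.lookup m t > 0" by blast
    then obtain m' where "Poly_Mapping.single m (Poly_Mapping.lookup b m) =
        Poly_Mapping.single m' (Poly_Mapping.lookup b m) * Var t"
      using single_conv_Var_mult[OF t(2), of "Poly_Mapping.lookup b m"] by (elim exE conjE)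
    then show ?thesis using ideal.subspace_scale[OF L f[OF t(1)]] by (simp add: mult.assoc)
  qed
  then have "(\<Sum>m\<in>Poly_Mapping.keys b. Poly_Mapping.single m (Poly_Mapping.lookup b m) * f) \<in> L"
    by (intro ideal.subspace_sum[OF L])
  then show ?thesis
    by (subst poly_mapping_expand[of b]) (simp add: sum_distrib_right)
qed

lemma lookup_Var_mult:
  "Poly_Mapping.lookup (Var t * p) (Poly_Mapping.single t 1 + m) = Poly_Mapping.lookup p m"
proof (induction p rule: poly_mapping_add_induct)
  case (single m' c)
  then show ?case by (simp add: Var_def mult_single lookup_single when_def)
qed (simp_all add: algebra_simps lookup_add)

lemma keys_Var_mult: "Poly_Mapping.keys (Var t * p) = (+) (Poly_Mapping.single t 1) ` Poly_Mapping.keys p"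
  for p :: "('v, 'k::comm_ring_1) mpoly"
proof
  show "Poly_Mapping.keys (Var t * p) \<subseteq> (+) (Poly_Mapping.single t 1) ` Poly_Mapping.keys p"
    using keys_mult[of "Var t" p] by (auto simp: Var_def)
qed (use lookup_Var_mult[of t p] in \<open>auto simp: in_keys_iff\<close>)

section \<open>Pushing forward along a map of monomials\<close>

text \<open>The induced linear map of monoid algebras, a ring homomorphism when \<open>f\<close> is
  additive. Substitutions of monomials for variables have this form.\<close>

definition push :: "('m \<Rightarrow> 'g) \<Rightarrow> ('m \<Rightarrow>\<^sub>0 'k::comm_ring_1) \<Rightarrow> 'g \<Rightarrow>\<^sub>0 'k" where
  "push f p = (\<Sum>m\<in>Poly_Mapping.keys p. Poly_Mapping.single (f m) (Poly_Mapping.lookup p m))"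

lemma push_superset:
  assumes "finite A" "Poly_Mapping.keys p \<subseteq> A"
  shows "push f p = (\<Sum>m\<in>A. Poly_Mapping.single (f m) (Poly_Mapping.lookup p m))"
  unfolding push_def by (rule sum.mono_neutral_left) (use assms in \<open>auto simp: in_keys_iff\<close>)

lemma push_zero [simp]: "push f 0 = 0"
  by (simp add: push_def)

lemma push_add: "push f (p + q) = push f p + push f q"
proof -
  let ?A = "Poly_Mapping.keys p \<union> Poly_Mapping.keys q"
  show ?thesis
    using Poly_Mapping.keys_add[of p q]
    by (simp add: push_superset[of ?A] sum.distrib lookup_add single_add)
qed

lemma push_single: "push f (Poly_Mapping.single m c) = Poly_Mapping.single (f m) c"
  by (cases "c = 0") (simp_all add: push_def)

lemma push_push: "push f (push g p) = push (\<lambda>m. f (g m)) p"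
  by (induction p rule: poly_mapping_add_induct) (simp_all add: push_single push_add)

lemma push_mult:
  fixes f :: "'m::comm_monoid_add \<Rightarrow> 'g::comm_monoid_add"
  assumes "\<And>m m'. f (m + m') = f m + f m'"
  shows "push f (p * q) = push f p * push f q"
proof (induction p rule: poly_mapping_add_induct)
  case (single m c)
  show ?case
  proof (induction q rule: poly_mapping_add_induct)
    case (single m' c')
    show ?case by (simp add: mult_single push_single assms)
  qed (simp_all add: push_add algebra_simps)
qed (simp_all add: push_add algebra_simps)

text \<open>Multiplication by the monomial of \<open>g\<close> only relocates coefficients,
  injectively by cancellation.\<close>

lemma monomial_mult_regular:
  fixes q :: "'g::cancel_comm_monoid_add \<Rightarrow>\<^sub>0 'k::comm_ring_1"
  assumes "Poly_Mapping.single g 1 * q = 0"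
  shows "q = 0"
proof (rule poly_mapping_eqI)
  fix k
  have "Poly_Mapping.lookup (Poly_Mapping.single g 1 * q) (g + k) = Poly_Mapping.lookup q k"
    by (induction q rule: poly_mapping_add_induct)
      (simp_all add: mult_single lookup_single when_def distrib_left lookup_add)
  then show "Poly_Mapping.lookup q k = Poly_Mapping.lookup 0 k"
    by (simp add: assms)
qed

section \<open>Regularity of variables modulo binomial edge ideals\<close>

lemma binomial_edge_ideal_subspace [simp]: "ideal.subspace (binomial_edge_ideal E)"
  by (simp add: binomial_edge_ideal_def)

lemma edge_binomial_mem: "{i, j} \<in> E \<Longrightarrow> edge_binomial i j \<in> binomial_edge_ideal E"
  unfolding binomial_edge_ideal_def by (rule ideal_gen_base) blast

lemma binomial_edge_ideal_minimal:
  assumes "\<And>i j. {i, j} \<in> E \<Longrightarrow> edge_binomial i j \<in> L" "ideal.subspace L"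
  shows "binomial_edge_ideal E \<subseteq> L"
  unfolding binomial_edge_ideal_def by (rule ideal_gen_minimal) (use assms in auto)

lemma binomial_edge_ideal_mono: "E \<subseteq> E' \<Longrightarrow> binomial_edge_ideal E \<subseteq> binomial_edge_ideal E'"
  by (intro binomial_edge_ideal_minimal edge_binomial_mem) auto

lemma binomial_edge_ideal_induct [consumes 1, case_names zero step]:
  assumes "p \<in> binomial_edge_ideal E" and "P 0"
    and "\<And>c i j q. {i, j} \<in> E \<Longrightarrow> q \<in> binomial_edge_ideal E \<Longrightarrow> P q \<Longrightarrow> P (c * edge_binomial i j + q)"
  shows "P p"
  using assms(1) unfolding binomial_edge_ideal_def
proof (induction rule: ideal_gen_induct)
  case (step c s q)
  then show ?case using assms(3) unfolding binomial_edge_ideal_def by blast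
qed (rule assms(2))

abbreviation xy :: "'n \<Rightarrow> 'n \<Rightarrow> 'n + 'n \<Rightarrow>\<^sub>0 nat" where
  "xy i j \<equiv> Poly_Mapping.single (Inl i) 1 + Poly_Mapping.single (Inr j) 1"

lemma edge_binomial_conv_single:
  "edge_binomial i j = Poly_Mapping.single (xy i j) 1 - Poly_Mapping.single (xy j i) 1"
  by (simp add: edge_binomial_def Var_def mult_single)

lemma keys_edge_binomial: "Poly_Mapping.keys (edge_binomial i j :: ('n + 'n, 'k::field) mpoly) \<subseteq> {xy i j, xy j i}"
  unfolding edge_binomial_conv_single
  by (auto simp: in_keys_iff lookup_minus lookup_single when_def split: if_splits)

lemma simple_graphD: "simple_graph E \<Longrightarrow> {i, j} \<in> E \<Longrightarrow> i \<noteq> j"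
  unfolding simple_graph_def by fastforce

section \<open>Simplicial vertices under completion and deletion at a vertex\<close>

definition simplicial :: "'n set set \<Rightarrow> 'n \<Rightarrow> bool" where
  "simplicial E v \<longleftrightarrow> clique E (neighbours E v)"

lemma simplicialD: "simplicial E v \<Longrightarrow> {v, p} \<in> E \<Longrightarrow> {v, q} \<in> E \<Longrightarrow> p \<noteq> q \<Longrightarrow> {p, q} \<in> E"
  by (simp add: simplicial_def clique_def neighbours_def)

lemma simplicialI: "(\<And>p q. {v, p} \<in> E \<Longrightarrow> {v, q} \<in> E \<Longrightarrow> p \<noteq> q \<Longrightarrow> {p, q} \<in> E) \<Longrightarrow> simplicial E v"
  by (simp add: simplicial_def clique_def neighbours_def)

lemma edge_completion_mem_iff:
  "{p, q} \<in> edge_completion E i j \<longleftrightarrow> {p, q} \<in> E \<or>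
     p \<noteq> q \<and> ({i, p} \<in> E \<and> {i, q} \<in> E \<or> {j, p} \<in> E \<and> {j, q} \<in> E)"
  by (auto simp: edge_completion_def neighbours_def doubleton_eq_iff)

lemma simple_graph_edge_completion: "simple_graph E \<Longrightarrow> simple_graph (edge_completion E i j)"
  by (auto simp: simple_graph_def edge_completion_def)

text \<open>If \<open>w\<close> gains an edge, it is a neighbour of \<open>v\<close>; as
  \<open>w\<close> is simplicial, its other old neighbours are neighbours of \<open>v\<close> too,
  and so are its new ones, hence the completion joins them all. So completing at \<open>v\<close>
  spoils no simplicial vertex.\<close>

lemma simplicial_edge_completion:
  assumes "simplicial E w"
  shows "simplicial (edge_completion E v v) w"
proof (rule simplicialI)
  fix p q
  assume *: "{w, p} \<in> edge_completion E v v" "{w, q} \<in> edge_completion E v v" "p \<noteq> q"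
  define A where "A a b \<longleftrightarrow> {a, b} \<in> E" for a b
  have A: "A a b \<Longrightarrow> A b a" for a b by (simp add: A_def insert_commute)
  have "A w a \<Longrightarrow> A w b \<Longrightarrow> a \<noteq> b \<Longrightarrow> A a b" for a b
    unfolding A_def by (rule simplicialD[OF assms])
  with * A show "{p, q} \<in> edge_completion E v v"
    unfolding edge_completion_mem_iff A_def[symmetric] by metis
qed

lemma simplicial_edge_completion_self:
  assumes "simple_graph E"
  shows "simplicial (edge_completion E v v) v"
proof (rule simplicialI)
  fix p q
  assume "{v, p} \<in> edge_completion E v v" "{v, q} \<in> edge_completion E v v" "p \<noteq> q"
  then show "{p, q} \<in> edge_completion E v v"
    unfolding edge_completion_mem_iff
    using simple_graphD[OF assms] by metis
qed

lemma simplicial_delete_vertex: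
  "simplicial E w \<Longrightarrow> simplicial {e \<in> E. v \<notin> e} w"
  by (rule simplicialI) (auto dest: simplicialD)

lemma simplicial_delete_vertex_self: "simplicial {e \<in> E. v \<notin> e} v"
  by (rule simplicialI) auto

text \<open>Expansion of the vanishing determinant with columns \<open>v\<close>, \<open>p\<close>,
  \<open>q\<close> in which the row of the x variables occurs twice and that of the y variables
  once.\<close>

lemma Inl_mult_edge_binomial:
  "Var (Inl v) * edge_binomial p q =
    Var (Inl p) * edge_binomial v q - Var (Inl q) * edge_binomial v p"
  by (simp add: edge_binomial_def algebra_simps)

lemma Inr_mult_edge_binomial:
  "Var (Inr v) * edge_binomial p q =
    Var (Inr p) * edge_binomial v q - Var (Inr q) * edge_binomial v p"
  by (simp add: edge_binomial_def algebra_simps)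

lemma Var_mult_edge_binomial_mem:
  assumes "{v, p} \<in> E" "{v, q} \<in> E" "t \<in> {Inl v, Inr v}"
  shows "Var t * edge_binomial p q \<in> binomial_edge_ideal E"
proof -
  have "Var s * edge_binomial v q - Var s' * edge_binomial v p \<in> binomial_edge_ideal E" for s s'
    by (intro ideal.subspace_diff[OF binomial_edge_ideal_subspace]
        ideal.subspace_scale[OF binomial_edge_ideal_subspace] edge_binomial_mem assms)
  then show ?thesis
    using assms(3) by (auto simp: Inl_mult_edge_binomial[of v p q] Inr_mult_edge_binomial[of v p q])
qed

section \<open>Setting the variables of a vertex to zero\<close>

definition kill :: "'n \<Rightarrow> ('n + 'n, 'k::comm_ring_1) mpoly \<Rightarrow> ('n + 'n, 'k) mpoly" where
  "kill v = restr (\<lambda>m. Poly_Mapping.lookup m (Inl v) = 0 \<and> Poly_Mapping.lookup m (Inr v) = 0)"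

lemma kill_mult: "kill v (p * q) = kill v p * kill v q"
  unfolding kill_def by (rule restr_mult) (auto simp: lookup_add)

lemma kill_add: "kill v (p + q) = kill v p + kill v q"
  unfolding kill_def by (rule restr_add)

lemma kill_diff: "kill v (p - q) = kill v p - kill v q"
  unfolding kill_def by (rule restr_diff)

lemma kill_zero [simp]: "kill v 0 = 0"
  by (simp add: kill_def)

lemma kill_Var: "kill v (Var t) = (if t \<in> {Inl v, Inr v} then 0 else Var t)"
  by (auto simp: kill_def Var_def restr_single lookup_single when_def)

lemma kill_edge_binomial: "kill v (edge_binomial i j) = (if v \<in> {i, j} then 0 else edge_binomial i j)"
  by (auto simp: edge_binomial_def kill_diff kill_Var kill_mult)

lemma kill_binomial_edge_ideal:
  assumes "p \<in> binomial_edge_ideal E"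
  shows "kill v p \<in> binomial_edge_ideal {e \<in> E. v \<notin> e}"
  using assms
proof (induction rule: binomial_edge_ideal_induct)
  case zero
  then show ?case by (simp add: ideal.subspace_0)
next
  case (step c i j q)
  have "kill v c * kill v (edge_binomial i j) \<in> binomial_edge_ideal {e \<in> E. v \<notin> e}"
    using step(1) by (auto simp: kill_edge_binomial ideal.subspace_0 edge_binomial_mem
      intro!: ideal.subspace_scale)
  then show ?case
    unfolding kill_add kill_mult
    by (rule ideal.subspace_add[OF binomial_edge_ideal_subspace _ step(3)])
qed

text \<open>
  Ohtani's decomposition: as \<open>x\<^sub>v\<close> and \<open>y\<^sub>v\<close> multiply the new generators of the completion into
  the ideal of \<open>E\<close>, the ideal of \<open>E\<close> is the intersection of that of its completion at \<open>v\<close> with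
  \<open>\<langle>x\<^sub>v, y\<^sub>v\<rangle> + J\<close>, where \<open>J\<close> is the ideal of \<open>E\<close> without \<open>v\<close>.
\<close>

lemma diff_kill_mem:
  assumes E: "simple_graph E" and "p \<in> binomial_edge_ideal (edge_completion E v v)"
  shows "p - kill v p \<in> binomial_edge_ideal E"
  using assms(2)
proof (induction rule: binomial_edge_ideal_induct)
  case zero
  then show ?case by (simp add: ideal.subspace_0)
next
  case (step c i j q)
  have "c * edge_binomial i j - kill v (c * edge_binomial i j) \<in> binomial_edge_ideal E"
  proof (cases "{i, j} \<in> E")
    case True
    then show ?thesis
      by (auto simp: kill_mult kill_edge_binomial edge_binomial_mem
          intro!: ideal.subspace_diff ideal.subspace_scale ideal.subspace_0)
  next
    case False
    with step(1) have ij: "i \<noteq> j" "{v, i} \<in> E" "{v, j} \<in> E"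
      by (auto simp: edge_completion_mem_iff)
    with simple_graphD[OF E] have "v \<notin> {i, j}" by auto
    then have "c * edge_binomial i j - kill v (c * edge_binomial i j) = (c - kill v c) * edge_binomial i j"
      by (simp add: kill_mult kill_edge_binomial algebra_simps)
    also have "\<dots> \<in> binomial_edge_ideal E"
    proof (rule mult_mem_of_vars)
      fix m assume "m \<in> Poly_Mapping.keys (c - kill v c)"
      then show "\<exists>t\<in>{Inl v, Inr v}. 0 < Poly_Mapping.lookup m t"
        by (auto simp: in_keys_iff kill_def lookup_minus lookup_restr split: if_splits)
    qed (rule binomial_edge_ideal_subspace, rule Var_mult_edge_binomial_mem[OF ij(2,3)])
    finally show ?thesis .
  qed
  from ideal.subspace_add[OF binomial_edge_ideal_subspace this step(3)]
  show ?case by (simp add: kill_add algebra_simps)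
qed

text \<open>If all vertices are simplicial, the graph is a disjoint union of cliques, and the closed
  neighbourhood of \<open>i\<close> is its clique. The weight is the exponent vector after
  substituting \<open>t_i\<close> for \<open>y_i\<close>, and \<open>t_i\<close> times the product
  of \<open>s_a\<close> over the closed neighbourhood of \<open>i\<close> for \<open>x_i\<close>;
  \<open>Inl\<close> indexes the \<open>t\<close> and \<open>Inr\<close> the
  \<open>s\<close>.\<close>

definition clique_weight :: "'n set set \<Rightarrow> ('n + 'n \<Rightarrow>\<^sub>0 nat) \<Rightarrow> 'n + 'n \<Rightarrow> nat" where
  "clique_weight E m = (\<lambda>s. case s of
      Inl i \<Rightarrow> Poly_Mapping.lookup m (Inl i) + Poly_Mapping.lookup m (Inr i)
    | Inr i \<Rightarrow> (\<Sum>j | j = i \<or> {i, j} \<in> E. Poly_Mapping.lookup m (Inl j)))"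

lemma clique_weight_add: "clique_weight E (m + m') = clique_weight E m + clique_weight E m'"
  by (auto simp: clique_weight_def fun_eq_iff lookup_add sum.distrib split: sum.splits)

text \<open>Adjacent vertices in a disjoint union of cliques have the same closed neighbourhood, so
  \<open>x_i\<close> and \<open>x_j\<close> contribute the same to the \<open>Inr\<close>
  entries.\<close>

lemma clique_weight_xy:
  fixes E :: "'n::finite set set"
  assumes "\<And>w. simplicial E w" "{i, j} \<in> E"
  shows "clique_weight E (xy i j) = clique_weight E (xy j i)"
proof -
  have "i = a \<or> {a, i} \<in> E \<longleftrightarrow> j = a \<or> {a, j} \<in> E" for a
  proof -
    have "{j, i} \<in> E" using assms(2) by (simp add: insert_commute)
    then show ?thesis
      using assms(2) simplicialD[OF assms(1), of i a j] simplicialD[OF assms(1), of j a i]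
      by (auto simp: insert_commute)
  qed
  then show ?thesis
    by (auto simp: clique_weight_def fun_eq_iff lookup_add lookup_single when_def split: sum.splits)
qed

text \<open>Exchanging \<open>x_i y_j\<close> for \<open>x_j y_i\<close> along an edge changes a
  monomial by a member of the ideal. Such exchanges lead from \<open>m\<close> to \<open>m'\<close>,
  each lowering the total excess of the x exponents of \<open>m\<close> over those of
  \<open>m'\<close>.\<close>

lemma single_diff_mem_of_clique_weight_eq:
  fixes E :: "'n::finite set set" and c :: "'k::field"
  assumes simp: "\<And>w. simplicial E w" and "clique_weight E m = clique_weight E m'"
  shows "Poly_Mapping.single m c - Poly_Mapping.single m' c \<in> binomial_edge_ideal E"
  using assms(2)
proof (induction "\<Sum>i\<in>UNIV. Poly_Mapping.lookup m (Inl i) - Poly_Mapping.lookup m' (Inl i)"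
    arbitrary: m rule: less_induct)
  case less
  let ?D = "\<lambda>m i. Poly_Mapping.lookup m (Inl i) - Poly_Mapping.lookup m' (Inl i)"
  have row: "Poly_Mapping.lookup m (Inl i) + Poly_Mapping.lookup m (Inr i)
      = Poly_Mapping.lookup m' (Inl i) + Poly_Mapping.lookup m' (Inr i)" for i
    using fun_cong[OF less.prems, of "Inl i"] by (simp add: clique_weight_def)
  have cl: "(\<Sum>j | j = i \<or> {i, j} \<in> E. Poly_Mapping.lookup m (Inl j))
      = (\<Sum>j | j = i \<or> {i, j} \<in> E. Poly_Mapping.lookup m' (Inl j))" for i
    using fun_cong[OF less.prems, of "Inr i"] by (simp add: clique_weight_def)
  show ?case
  proof (cases "\<exists>i. Poly_Mapping.lookup m (Inl i) \<noteq> Poly_Mapping.lookup m' (Inl i)")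
    case False
    have "m = m'"
    proof (rule poly_mapping_eqI)
      fix s show "Poly_Mapping.lookup m s = Poly_Mapping.lookup m' s"
        using False row by (cases s) (auto simp: add_left_cancel)
    qed
    then show ?thesis by (simp add: ideal.subspace_0)
  next
    case True
    \<comment> \<open>Without any excess, a difference at \<open>i\<close> would make the sum over
      the clique of \<open>i\<close> strictly smaller for \<open>m\<close>.\<close>
    have "\<exists>i. Poly_Mapping.lookup m (Inl i) > Poly_Mapping.lookup m' (Inl i)"
    proof (rule ccontr)
      assume *: "\<not> ?thesis"
      from True obtain i where "Poly_Mapping.lookup m (Inl i) \<noteq> Poly_Mapping.lookup m' (Inl i)" by blast
      with * have "Poly_Mapping.lookup m (Inl i) < Poly_Mapping.lookup m' (Inl i)"
        by (meson linorder_neqE_nat)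
      then have "(\<Sum>j | j = i \<or> {i, j} \<in> E. Poly_Mapping.lookup m (Inl j))
          < (\<Sum>j | j = i \<or> {i, j} \<in> E. Poly_Mapping.lookup m' (Inl j))"
        by (intro sum_strict_mono_ex1) (use * in \<open>auto simp: not_less\<close>)
      with cl[of i] show False by simp
    qed
    then obtain i where i: "Poly_Mapping.lookup m (Inl i) > Poly_Mapping.lookup m' (Inl i)" by blast
    \<comment> \<open>Since the sums over the clique of \<open>i\<close> agree, the excess at
      \<open>i\<close> is offset by a deficit in the same clique.\<close>
    have "\<exists>j. (j = i \<or> {i, j} \<in> E) \<and> Poly_Mapping.lookup m (Inl j) < Poly_Mapping.lookup m' (Inl j)"
    proof (rule ccontr)
      assume *: "\<not> ?thesis"
      have "(\<Sum>j | j = i \<or> {i, j} \<in> E. Poly_Mapping.lookup m' (Inl j))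
          < (\<Sum>j | j = i \<or> {i, j} \<in> E. Poly_Mapping.lookup m (Inl j))"
        by (intro sum_strict_mono_ex1) (use * i in \<open>auto simp: not_less\<close>)
      with cl[of i] show False by simp
    qed
    then obtain j where j: "j = i \<or> {i, j} \<in> E" "Poly_Mapping.lookup m (Inl j) < Poly_Mapping.lookup m' (Inl j)"
      by blast
    with i have ij: "i \<noteq> j" "{i, j} \<in> E" by auto
    \<comment> \<open>The total degree at \<open>j\<close> agrees, so a deficit in
      \<open>x_j\<close> forces a positive exponent of \<open>y_j\<close>.\<close>
    have yj: "Poly_Mapping.lookup m (Inr j) > 0" using row[of j] j by linarith
    define n where "n = m - xy i j"
    have m: "m = n + xy i j"
      unfolding n_def using i yj
      by (intro poly_mapping_eqI) (auto simp: lookup_add lookup_minus lookup_single when_def)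
    define m1 where "m1 = n + xy j i"
    have lm: "Poly_Mapping.lookup m (Inl a) = Poly_Mapping.lookup n (Inl a) + (if a = i then 1 else 0)" for a
      by (simp add: m lookup_add lookup_single when_def)
    have lm1: "Poly_Mapping.lookup m1 (Inl a) = Poly_Mapping.lookup n (Inl a) + (if a = j then 1 else 0)" for a
      by (simp add: m1_def lookup_add lookup_single when_def)
    have "(\<Sum>a\<in>UNIV. ?D m1 a) < (\<Sum>a\<in>UNIV. ?D m a)"
    proof (rule sum_strict_mono_ex1)
      show "\<forall>a\<in>UNIV. ?D m1 a \<le> ?D m a"
        using lm lm1 ij j by auto
      show "\<exists>a\<in>UNIV. ?D m1 a < ?D m a"
        using lm[of i] lm1[of i] ij i by (intro bexI[of _ i]) auto
    qed simp
    moreover have "clique_weight E m1 = clique_weight E m'"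
      using clique_weight_xy[OF simp ij(2)] less.prems by (simp add: m m1_def clique_weight_add)
    ultimately have 1: "Poly_Mapping.single m1 c - Poly_Mapping.single m' c \<in> binomial_edge_ideal E"
      by (rule less.hyps)
    have 2: "Poly_Mapping.single n c * edge_binomial i j \<in> binomial_edge_ideal E"
      using ij by (intro ideal.subspace_scale edge_binomial_mem) auto
    have "Poly_Mapping.single n c * edge_binomial i j = Poly_Mapping.single m c - Poly_Mapping.single m1 c"
      by (simp add: edge_binomial_conv_single right_diff_distrib mult_single m m1_def)
    with ideal.subspace_add[OF binomial_edge_ideal_subspace 2 1] show ?thesis
      by simp
  qed
qed

text \<open>For a disjoint union of cliques the ideal is toric: binomials map to zero, and monomials
  with the same image are congruent by the previous lemma.\<close>

lemma mem_iff_push_clique_weight: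
  fixes E :: "'n::finite set set" and p :: "('n + 'n, 'k::field) mpoly"
  assumes simp: "\<And>w. simplicial E w"
  shows "p \<in> binomial_edge_ideal E \<longleftrightarrow> push (clique_weight E) p = 0"
proof
  assume "p \<in> binomial_edge_ideal E"
  then show "push (clique_weight E) p = 0"
  proof (induction rule: binomial_edge_ideal_induct)
    case (step c i j q)
    have "push (clique_weight E) (edge_binomial i j :: ('n + 'n, 'k) mpoly) + Poly_Mapping.single (clique_weight E (xy j i)) 1
        = Poly_Mapping.single (clique_weight E (xy i j)) 1"
      by (simp add: edge_binomial_conv_single push_add[symmetric] flip: push_single)
    then have "push (clique_weight E) (edge_binomial i j :: ('n + 'n, 'k) mpoly) = 0"
      using clique_weight_xy[OF simp step(1)] by simp
    with step show ?case by (simp add: push_add push_mult clique_weight_add)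
  qed simp
next
  assume p: "push (clique_weight E) p = 0"
  \<comment> \<open>One monomial is chosen in each fibre of the weight. Replacing every monomial by
    its representative changes a polynomial by a member of the ideal, and it factors through
    \<open>push (clique_weight E)\<close>, so it sends \<open>p\<close> to zero.\<close>
  define rep where "rep g = (SOME m. clique_weight E m = g)" for g
  have rep: "clique_weight E (rep (clique_weight E m)) = clique_weight E m" for m
    unfolding rep_def by (rule someI) simp
  have "q - push (\<lambda>m. rep (clique_weight E m)) q \<in> binomial_edge_ideal E" for q :: "('n + 'n, 'k) mpoly"
  proof (induction q rule: poly_mapping_add_induct)
    case zero
    show ?case by (simp add: ideal.subspace_0)
  next
    case (single m c)
    show ?case
      unfolding push_single by (intro single_diff_mem_of_clique_weight_eq simp) (simp add: rep)
  next
    case (add p q)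
    from ideal.subspace_add[OF binomial_edge_ideal_subspace this]
    show ?case by (simp add: push_add algebra_simps)
  qed
  from this[of p] show "p \<in> binomial_edge_ideal E"
    using p by (simp flip: push_push)
qed

text \<open>Induction on the number of vertices that are not simplicial. If there are none, the
  ideal is toric and the variable maps to a monomial. Otherwise completion and deletion at such a
  vertex \<open>v\<close> both leave fewer of them, and \<open>p\<close> is recovered as
  \<open>(p - kill v p) + kill v p\<close>.\<close>

lemma Var_regular:
  fixes E :: "'n::finite set set" and p :: "('n + 'n, 'k::field) mpoly"
  assumes "simple_graph E" "simplicial E w" "t \<in> {Inl w, Inr w}" "Var t * p \<in> binomial_edge_ideal E"
  shows "p \<in> binomial_edge_ideal E"
  using assms
proof (induction "card {v. \<not> simplicial E v}" arbitrary: E p rule: less_induct)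
  case less
  show ?case
  proof (cases "\<forall>v. simplicial E v")
    case True
    then have *: "\<And>v. simplicial E v" by blast
    from less.prems(4) have "push (clique_weight E) (Var t) * push (clique_weight E) p = 0"
      by (simp add: mem_iff_push_clique_weight[OF *] push_mult clique_weight_add)
    then have "Poly_Mapping.single (clique_weight E (Poly_Mapping.single t 1)) 1 * push (clique_weight E) p = 0"
      by (simp add: Var_def push_single)
    then have "push (clique_weight E) p = 0"
      by (rule monomial_mult_regular)
    then show ?thesis by (simp add: mem_iff_push_clique_weight[OF *])
  next
    case False
    then obtain v where v: "\<not> simplicial E v" by blast
    let ?C = "edge_completion E v v" and ?D = "{e \<in> E. v \<notin> e}"
    have c: "{a. \<not> simplicial ?C a} \<subset> {a. \<not> simplicial E a}"
      using v simplicial_edge_completion[of E _ v] simplicial_edge_completion_self[OF less.prems(1), of v]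
      by auto
    have "E \<subseteq> ?C" by (auto simp: edge_completion_def)
    then have "Var t * p \<in> binomial_edge_ideal ?C"
      using less.prems(4) binomial_edge_ideal_mono[of E ?C] by blast
    from less.hyps[OF psubset_card_mono[OF _ c] simple_graph_edge_completion[OF less.prems(1)]
        simplicial_edge_completion[OF less.prems(2)] less.prems(3) this]
    have C: "p \<in> binomial_edge_ideal ?C" by simp
    have d: "{a. \<not> simplicial ?D a} \<subset> {a. \<not> simplicial E a}"
      using v simplicial_delete_vertex[of E _ v] simplicial_delete_vertex_self[of E v] by auto
    \<comment> \<open>As \<open>w\<close> is simplicial and \<open>v\<close> is not, they differ,
      and \<open>kill v\<close> fixes \<open>Var t\<close>.\<close>
    have 2: "Var t * kill v p \<in> binomial_edge_ideal ?D"
      using kill_binomial_edge_ideal[OF less.prems(4), of v] v less.prems(2,3)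
      by (auto simp: kill_mult kill_Var split: if_splits)
    have "simple_graph ?D" using less.prems(1) by (simp add: simple_graph_def)
    from less.hyps[OF psubset_card_mono[OF _ d] this
        simplicial_delete_vertex[OF less.prems(2)] less.prems(3) 2]
    have "kill v p \<in> binomial_edge_ideal ?D" by simp
    then have "kill v p \<in> binomial_edge_ideal E"
      using binomial_edge_ideal_mono[of ?D E] by auto
    from ideal.subspace_add[OF binomial_edge_ideal_subspace diff_kill_mem[OF less.prems(1) C] this] show ?thesis
      by simp
  qed
qed

text \<open>Let the weight count x variables with index in \<open>C\<close>. No edge leaves
  \<open>C\<close>, so the ideal is homogeneous for it, while the terms \<open>x_u y_v\<close> and
  \<open>x_v y_u\<close> have weights 0 and 1. Hence the top component \<open>q\<close> of
  \<open>p\<close> satisfies \<open>x_v y_u q \<in> J\<close>, lies in the ideal by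
  \<open>Var_regular\<close>, and can be removed, which leaves fewer monomials.\<close>

lemma edge_binomial_regular:
  fixes E :: "'n::finite set set" and p :: "('n + 'n, 'k::field) mpoly"
  assumes E: "simple_graph E" and u: "simplicial E u" and v: "simplicial E v"
    and C: "\<And>i j. {i, j} \<in> E \<Longrightarrow> i \<in> C \<longleftrightarrow> j \<in> C" "v \<in> C" "u \<notin> C"
    and p: "edge_binomial u v * p \<in> binomial_edge_ideal E"
  shows "p \<in> binomial_edge_ideal E"
  using p
proof (induction "card (Poly_Mapping.keys p)" arbitrary: p rule: less_induct)
  case less
  let ?J = "binomial_edge_ideal E :: ('n + 'n, 'k) mpoly set"
  define W :: "('n + 'n \<Rightarrow>\<^sub>0 nat) \<Rightarrow> int" where
    "W m = (\<Sum>i\<in>C. int (Poly_Mapping.lookup m (Inl i)))" for m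
  have W_add: "W (m + m') = W m + W m'" for m m'
    by (simp add: W_def lookup_add sum.distrib)
  have W_xy: "W (xy i j) = (if i \<in> C then 1 else 0)" for i j
    by (simp add: W_def lookup_add lookup_single when_def if_distrib[of int] cong: if_cong)
  have W_comp: "restr (\<lambda>m. W m = d) q \<in> ?J" if "q \<in> ?J" for q d
    using that unfolding binomial_edge_ideal_def
  proof (rule restr_in_ideal_gen[OF W_add, rotated 1])
    fix s :: "('n + 'n, 'k) mpoly"
    assume "s \<in> {edge_binomial i j |i j. {i, j} \<in> E}"
    then obtain i j where s: "s = edge_binomial i j" "{i, j} \<in> E" by blast
    have "W m = (if i \<in> C then 1 else 0)" if m: "m \<in> Poly_Mapping.keys s" for m
    proof -
      from m s keys_edge_binomial[of i j, where ?'k = 'k] have "m = xy i j \<or> m = xy j i" by blast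
      with C(1)[OF s(2)] show ?thesis by (metis W_xy)
    qed
    then show "\<exists>h. \<forall>m\<in>Poly_Mapping.keys s. W m = h" by blast
  qed
  show ?case
  proof (cases "p = 0")
    case True
    then show ?thesis by (simp add: ideal.subspace_0)
  next
    case False
    define D where "D = Max (W ` Poly_Mapping.keys p)"
    define q where "q = restr (\<lambda>m. W m = D) p"
    have ne: "W ` Poly_Mapping.keys p \<noteq> {}" using False by simp
    have D: "W m \<le> D" if "m \<in> Poly_Mapping.keys p" for m
      unfolding D_def using that by (intro Max_ge) auto
    have top: "restr (\<lambda>m. W m = D + 1) p = 0"
      by (rule restr_eq_zero) (use D in force)
    have W_uv: "W (xy u v) = 0" and W_vu: "W (xy v u) = 1"
      unfolding W_xy using C by auto
    have 1: "restr (\<lambda>m. W m = D + 1) (Poly_Mapping.single (xy u v) 1 * p)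
        = Poly_Mapping.single (xy u v) 1 * restr (\<lambda>m. W m = D + 1) p"
      by (rule restr_mult_homogeneous) (use W_uv in \<open>auto simp: W_add simp del: One_nat_def\<close>)
    have 2: "restr (\<lambda>m. W m = D + 1) (Poly_Mapping.single (xy v u) 1 * p)
        = Poly_Mapping.single (xy v u) 1 * q"
      unfolding q_def
      by (rule restr_mult_homogeneous) (use W_vu in \<open>auto simp: W_add simp del: One_nat_def\<close>)
    \<comment> \<open>In weight \<open>D + 1\<close> the term \<open>x_u y_v\<close> would need a
      component of \<open>p\<close> above the maximal weight \<open>D\<close>.\<close>
    have "restr (\<lambda>m. W m = D + 1) (edge_binomial u v * p) = - (Poly_Mapping.single (xy v u) 1 * q)"
      unfolding edge_binomial_conv_single left_diff_distrib restr_diff 1 2 top by simp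
    with W_comp[OF less.prems, of "D + 1"]
    have "- (Poly_Mapping.single (xy v u) 1 * q) \<in> ?J" by simp
    from ideal.subspace_neg[OF binomial_edge_ideal_subspace this]
    have "Var (Inl v) * (Var (Inr u) * q) \<in> ?J"
      by (simp add: Var_def mult_single flip: mult.assoc)
    then have "Var (Inr u) * q \<in> ?J"
      by (rule Var_regular[OF E v, rotated 1]) simp
    then have q: "q \<in> ?J"
      by (rule Var_regular[OF E u, rotated 1]) simp
    have pq: "edge_binomial u v * (p - q) \<in> ?J"
      unfolding right_diff_distrib
      by (intro ideal.subspace_diff[OF binomial_edge_ideal_subspace] less.prems
          ideal.subspace_scale[OF binomial_edge_ideal_subspace] q)
    have keys: "Poly_Mapping.keys (p - q) = Poly_Mapping.keys p - {m. W m = D}"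
      by (auto simp: q_def in_keys_iff lookup_minus lookup_restr split: if_splits)
    obtain m where "m \<in> Poly_Mapping.keys p" "W m = D"
      using Max_in[OF _ ne] by (auto simp: D_def)
    then have "card (Poly_Mapping.keys (p - q)) < card (Poly_Mapping.keys p)"
      unfolding keys by (intro psubset_card_mono) auto
    from less.hyps[OF this pq] ideal.subspace_add[OF binomial_edge_ideal_subspace _ q, of "p - q"]
    show ?thesis by simp
  qed
qed

lemma binomial_edge_ideal_empty [simp]: "binomial_edge_ideal {} = {0}"
  by (simp add: binomial_edge_ideal_def ideal_gen_def)

text \<open>The edgeless graph has the zero ideal, and \<open>{v}\<close> separates \<open>v\<close>
  from \<open>u\<close> in it.\<close>

lemma edge_binomial_mult_eq_0_iff [simp]:
  fixes u v :: "'n::finite" and p :: "('n + 'n, 'k::field) mpoly"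
  assumes "u \<noteq> v"
  shows "edge_binomial u v * p = 0 \<longleftrightarrow> p = 0"
proof
  assume "edge_binomial u v * p = 0"
  then have "p \<in> binomial_edge_ideal {}"
    by (intro edge_binomial_regular[of "{}" u v "{v}" p])
      (use assms in \<open>auto simp: simple_graph_def intro: simplicialI\<close>)
  then show "p = 0" by simp
qed simp

section \<open>The colon ideal of a cut edge\<close>

text \<open>The neighbours of \<open>v\<close> already form a clique, so each new edge joins two
  neighbours of \<open>u\<close>, and the determinantal relation at \<open>u\<close> applies to
  it.\<close>

lemma edge_completion_binomial_Var_mem:
  assumes v: "simplicial E v" and t: "t \<in> {Inl u, Inr u}"
    and p: "p \<in> binomial_edge_ideal (edge_completion E u v)"
  shows "Var t * p \<in> binomial_edge_ideal E"
proof -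
  have "binomial_edge_ideal (edge_completion E u v) \<subseteq> {p. Var t * p \<in> binomial_edge_ideal E}"
  proof (rule binomial_edge_ideal_minimal)
    fix i j assume ij: "{i, j} \<in> edge_completion E u v"
    have "Var t * edge_binomial i j \<in> binomial_edge_ideal E"
    proof (cases "{u, i} \<in> E \<and> {u, j} \<in> E")
      case True
      then show ?thesis by (intro Var_mult_edge_binomial_mem[OF _ _ t]) auto
    next
      case False
      with ij simplicialD[OF v, of i j] have "{i, j} \<in> E"
        unfolding edge_completion_mem_iff by auto
      then show ?thesis
        by (intro ideal.subspace_scale[OF binomial_edge_ideal_subspace] edge_binomial_mem)
    qed
    then show "edge_binomial i j \<in> {p. Var t * p \<in> binomial_edge_ideal E}" by simp
  next
    let ?J = "binomial_edge_ideal E"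
    show "ideal.subspace {p. Var t * p \<in> ?J}"
    proof (rule ideal.subspaceI, goal_cases)
      case 1
      show ?case by (simp add: ideal.subspace_0)
    next
      case (2 p q)
      then show ?case using ideal.subspace_add[of ?J "Var t * p" "Var t * q"] by (simp add: distrib_left)
    next
      case (3 c p)
      then show ?case using ideal.subspace_scale[of ?J "Var t * p" c] by (simp add: mult.left_commute)
    qed
  qed
  with p show ?thesis by blast
qed

text \<open>The situation after the cut-edge has been removed: \<open>E\<close> is the remaining
  graph, and \<open>C\<close> is a union of components containing \<open>v\<close> but not
  \<open>u\<close>.\<close>

locale separated_simplicial =
  fixes E :: "'n::finite set set" and u v :: 'n and C :: "'n set"
  assumes simple: "simple_graph E"
    and simplicial: "simplicial E v"
    and closed: "\<And>i j. {i, j} \<in> E \<Longrightarrow> i \<in> C \<longleftrightarrow> j \<in> C"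
    and v_in: "v \<in> C" and u_notin: "u \<notin> C"
begin

lemma neq: "u \<noteq> v"
  using v_in u_notin by auto

lemma completion_closed: "{i, j} \<in> edge_completion E u v \<Longrightarrow> i \<in> C \<longleftrightarrow> j \<in> C"
  unfolding edge_completion_mem_iff using closed by meson

text \<open>A new edge at \<open>u\<close> or \<open>v\<close> would make that vertex a neighbour of
  itself or of the other one, which lies across the boundary of \<open>C\<close>.\<close>

lemma completion_edges_at:
  assumes "a \<in> {u, v}"
  shows "{a, p} \<in> edge_completion E u v \<longleftrightarrow> {a, p} \<in> E"
proof
  assume *: "{a, p} \<in> edge_completion E u v"
  show "{a, p} \<in> E"
  proof (rule ccontr)
    assume "{a, p} \<notin> E"
    with * have "{u, a} \<in> E \<or> {v, a} \<in> E" by (auto simp: edge_completion_mem_iff)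
    with assms closed[of u v] closed[of v u] v_in u_notin simple_graphD[OF simple] show False
      by blast
  qed
qed (simp add: edge_completion_mem_iff)

lemma completion_simplicial:
  assumes "a \<in> {u, v}"
  shows "simplicial (edge_completion E u v) a"
proof (rule simplicialI)
  fix p q assume "{a, p} \<in> edge_completion E u v" "{a, q} \<in> edge_completion E u v" "p \<noteq> q"
  with completion_edges_at[OF assms] have "{a, p} \<in> E" "{a, q} \<in> E" "p \<noteq> q" by auto
  with assms show "{p, q} \<in> edge_completion E u v" unfolding edge_completion_mem_iff by auto
qed

text \<open>The colon ideal of \<open>f\<close> is that of the completion: one inclusion is
  regularity of \<open>f\<close> modulo the larger ideal, the other expresses \<open>f\<close>
  through \<open>x_u\<close> and \<open>y_u\<close>, which multiply the larger ideal into the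
  smaller.\<close>

lemma mult_mem_iff:
  fixes p :: "('n + 'n, 'k::field) mpoly"
  shows "edge_binomial u v * p \<in> binomial_edge_ideal E
    \<longleftrightarrow> p \<in> binomial_edge_ideal (edge_completion E u v)"
proof
  assume "edge_binomial u v * p \<in> binomial_edge_ideal E"
  then have "edge_binomial u v * p \<in> binomial_edge_ideal (edge_completion E u v)"
    using binomial_edge_ideal_mono[of E "edge_completion E u v"]
    by (auto simp: edge_completion_def)
  then show "p \<in> binomial_edge_ideal (edge_completion E u v)"
    by (rule edge_binomial_regular[rotated -1])
      (use simple_graph_edge_completion[OF simple] completion_simplicial completion_closed v_in u_notin in auto)
next
  assume p: "p \<in> binomial_edge_ideal (edge_completion E u v)"
  have "edge_binomial u v * p = Var (Inr v) * (Var (Inl u) * p) - Var (Inl v) * (Var (Inr u) * p)"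
    by (simp add: edge_binomial_def algebra_simps)
  also have "\<dots> \<in> binomial_edge_ideal E"
    by (intro ideal.subspace_diff[OF binomial_edge_ideal_subspace]
        ideal.subspace_scale[OF binomial_edge_ideal_subspace]
        edge_completion_binomial_Var_mem[OF simplicial _ p]) auto
  finally show "edge_binomial u v * p \<in> binomial_edge_ideal E" .
qed

lemma inter_principal:
  "binomial_edge_ideal E \<inter> ideal_gen {edge_binomial u v :: ('n + 'n, 'k::field) mpoly}
    = (*) (edge_binomial u v) ` binomial_edge_ideal (edge_completion E u v)"
  unfolding ideal_gen_singleton using mult_mem_iff by (fastforce simp: mult.commute)

end

text \<open>The set \<open>C\<close> is the component of \<open>v\<close> after the edge is
  deleted.\<close>

lemma separated_simplicial_cut_edge:
  fixes E :: "'n::finite set set"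
  assumes E: "simple_graph E" and cut: "cut_edge E {u, v}"
    and free: "free_vertex (delete_edge E {u, v}) v"
  shows "\<exists>C. separated_simplicial (delete_edge E {u, v}) u v C"
proof -
  let ?E = "delete_edge E {u, v}"
  let ?R = "{(i, j). {i, j} \<in> E}" and ?S = "{(i, j). {i, j} \<in> ?E}"
  have sym: "sym (?S\<^sup>*)"
    by (rule sym_rtrancl) (auto simp: sym_def insert_commute)
  \<comment> \<open>Were \<open>u\<close> still reachable, deleting the edge would not change
    reachability, and the number of components could not grow.\<close>
  have vu: "(v, u) \<notin> ?S\<^sup>*"
  proof
    assume vu: "(v, u) \<in> ?S\<^sup>*"
    with sym have "(u, v) \<in> ?S\<^sup>*" by (auto dest: symD)
    with vu have "?R \<subseteq> ?S\<^sup>*"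
      by (auto simp: delete_edge_def doubleton_eq_iff)
    then have "?R\<^sup>* \<subseteq> ?S\<^sup>*"
      by (metis rtrancl_mono rtrancl_idemp)
    moreover have "?S\<^sup>* \<subseteq> ?R\<^sup>*"
      by (rule rtrancl_mono) (auto simp: delete_edge_def)
    ultimately show False
      using cut by (simp add: cut_edge_def connected_components_def)
  qed
  have simple: "simple_graph ?E" using E by (simp add: simple_graph_def delete_edge_def)
  have "simplicial ?E v"
  proof (rule simplicialI)
    fix p q assume pq: "{v, p} \<in> ?E" "{v, q} \<in> ?E" "p \<noteq> q"
    \<comment> \<open>Every edge at \<open>v\<close> extends to a maximal clique, and uniqueness of
      the one through \<open>v\<close> puts \<open>p\<close> and \<open>q\<close> into the same
      clique.\<close>
    have ex: "\<exists>C. maximal_clique ?E C \<and> {v, a} \<subseteq> C" if "{v, a} \<in> ?E" for a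
    proof -
      have "{v, a} \<in> Collect (clique ?E)"
        using that by (auto simp: clique_def insert_commute)
      from finite_has_maximal2[OF _ this] show ?thesis
        unfolding maximal_clique_def by auto
    qed
    from ex[OF pq(1)] ex[OF pq(2)] free obtain C where "maximal_clique ?E C" "p \<in> C" "q \<in> C"
      unfolding free_vertex_def by blast
    with pq(3) show "{p, q} \<in> ?E" by (auto simp: maximal_clique_def clique_def)
  qed
  moreover have "i \<in> ?S\<^sup>* `` {v} \<longleftrightarrow> j \<in> ?S\<^sup>* `` {v}" if "{i, j} \<in> ?E" for i j
  proof -
    have "(i, j) \<in> ?S" "(j, i) \<in> ?S" using that by (auto simp: insert_commute)
    then show ?thesis by (auto intro: rtrancl_into_rtrancl)
  qed
  ultimately have "separated_simplicial ?E u v (?S\<^sup>* `` {v})"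
    using simple vu by unfold_locales auto
  then show ?thesis ..
qed

section \<open>Minimal generators of binomial edge ideals\<close>

lemma mon_degree_add:
  fixes m m' :: "'v::finite \<Rightarrow>\<^sub>0 nat"
  shows "mon_degree (m + m') = mon_degree m + mon_degree m'"
proof -
  have "mon_degree m = (\<Sum>v\<in>UNIV. Poly_Mapping.lookup m v)" for m :: "'v \<Rightarrow>\<^sub>0 nat"
    unfolding mon_degree_def by (rule sum.mono_neutral_left) (auto simp: in_keys_iff)
  then show ?thesis by (simp add: lookup_add sum.distrib)
qed

lemma mon_degree_single [simp]: "mon_degree (Poly_Mapping.single t c) = c"
  by (cases "c = 0") (simp_all add: mon_degree_def)

lemma graded_piece_edge_binomial:
  "edge_binomial i j \<in> (graded_piece 2 :: ('n::finite + 'n, 'k::field) mpoly set)"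
  using keys_edge_binomial[of i j, where ?'k = 'k] by (auto simp: graded_piece_def mon_degree_add)

lemma edge_binomial_swap: "edge_binomial j i = - edge_binomial i j"
  by (simp add: edge_binomial_def)

text \<open>If a monomial of a product divides \<open>M\<close>, so does its factor from
  \<open>x\<close>. The ideal is used to certify non-membership: for \<open>M = xy i j\<close> in
  proving minimality, for \<open>M = 0\<close> in excluding constant terms.\<close>

lemma no_divisor_subspace:
  "ideal.subspace {p. \<forall>m n. m + n = M \<longrightarrow> Poly_Mapping.lookup p m = 0}"
proof (rule ideal.subspaceI, goal_cases)
  case (3 c x)
  have "Poly_Mapping.lookup (c * x) m = 0" if "m + n = M" for m n
  proof (rule ccontr)
    assume "Poly_Mapping.lookup (c * x) m \<noteq> 0"
    then obtain a b where "m = a + b" "b \<in> Poly_Mapping.keys x"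
      using keys_mult[of c x] by (auto simp: in_keys_iff)
    moreover from this that have "b + (a + n) = M" by (simp add: algebra_simps)
    ultimately show False using 3 by (auto simp: in_keys_iff)
  qed
  then show ?case by blast
qed (auto simp: lookup_add)

lemma xy_dvd_eq:
  assumes "xy i j + n = xy a b"
  shows "i = a \<and> j = b"
proof -
  have "Poly_Mapping.lookup (xy i j + n) (Inl i) > 0" "Poly_Mapping.lookup (xy i j + n) (Inr j) > 0"
    by (simp_all add: lookup_add)
  then show ?thesis
    unfolding assms by (auto simp: lookup_add lookup_single when_def split: if_splits)
qed

text \<open>The functions \<open>a\<close> and \<open>b\<close> orient each edge, because both
  \<open>edge_binomial i j\<close> and its negative occur among the defining generators. No monomial
  of another generator divides the term \<open>xy i j\<close> of an omitted one, so the latter is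
  not in the ideal of the rest.\<close>

lemma minimal_generators_edge_binomials:
  fixes E :: "'n::finite set set"
  assumes E: "simple_graph E" and or: "\<And>e. e \<in> E \<Longrightarrow> {a e, b e} = e"
  shows "minimal_homogeneous_generators
    ((\<lambda>e. edge_binomial (a e) (b e)) ` E) (binomial_edge_ideal E :: ('n + 'n, 'k::field) mpoly set)"
    (is "minimal_homogeneous_generators (?g ` E) ?J")
  unfolding minimal_homogeneous_generators_def
proof (intro conjI allI impI)
  show "\<forall>g\<in>?g ` E. homogeneous g"
    using graded_piece_edge_binomial by (auto simp: homogeneous_def)
  show "ideal_gen (?g ` E) = ?J"
  proof
    show "ideal_gen (?g ` E) \<subseteq> ?J"
      by (rule ideal_gen_minimal) (auto simp: or intro!: edge_binomial_mem)
    show "?J \<subseteq> ideal_gen (?g ` E)"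
    proof (rule binomial_edge_ideal_minimal)
      fix i j assume ij: "{i, j} \<in> E"
      then have g: "?g {i, j} \<in> ideal_gen (?g ` E)" by (intro ideal_gen_base) auto
      from or[OF ij] consider "a {i, j} = i" "b {i, j} = j" | "a {i, j} = j" "b {i, j} = i"
        by (auto simp: doubleton_eq_iff)
      then show "edge_binomial i j \<in> ideal_gen (?g ` E)"
      proof cases
        case 1
        with g show ?thesis by simp
      next
        case 2
        with ideal.subspace_neg[OF ideal_gen_subspace g] show ?thesis
          by (simp add: edge_binomial_swap[of i j])
      qed
    qed simp
  qed
next
  fix B assume "B \<subset> ?g ` E"
  then obtain e where e: "e \<in> E" "?g e \<notin> B" and B: "B \<subseteq> ?g ` E" by blast
  define i j where "i = a e" and "j = b e"
  have ij: "{i, j} = e" "i \<noteq> j"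
    using or[OF e(1)] simple_graphD[OF E, of i j] e(1) by (auto simp: i_def j_def)
  let ?Q = "{p :: ('n + 'n, 'k) mpoly. \<forall>m n. m + n = xy i j \<longrightarrow> Poly_Mapping.lookup p m = 0}"
  have "B \<subseteq> ?Q"
  proof (rule subsetI, rule CollectI, intro allI impI, rule ccontr)
    fix g m n
    assume g: "g \<in> B" "m + n = xy i j" "Poly_Mapping.lookup g m \<noteq> 0"
    from g(1) B obtain e' where e': "e' \<in> E" "g = ?g e'" by blast
    from g(3) keys_edge_binomial[of "a e'" "b e'", where ?'k = 'k]
    have "m = xy (a e') (b e') \<or> m = xy (b e') (a e')"
      by (auto simp: e' in_keys_iff)
    with g(2) xy_dvd_eq[of "a e'" "b e'" n i j] xy_dvd_eq[of "b e'" "a e'" n i j]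
    have "a e' = i \<and> b e' = j \<or> b e' = i \<and> a e' = j" by auto
    with or[OF e'(1)] ij have "e' = e" by auto
    with e' g(1) e show False by simp
  qed
  then have "ideal_gen B \<subseteq> ?Q"
    by (rule ideal_gen_minimal[OF _ no_divisor_subspace])
  moreover have "edge_binomial i j \<notin> ?Q"
  proof
    assume "edge_binomial i j \<in> ?Q"
    then have "Poly_Mapping.lookup (edge_binomial i j :: ('n + 'n, 'k) mpoly) (xy i j) = 0"
      by (auto dest: spec[of _ "xy i j"] spec[of _ 0])
    moreover have "xy i j \<noteq> xy j i" using ij(2) xy_dvd_eq[of j i 0 i j] by auto
    ultimately show False
      by (simp add: edge_binomial_conv_single lookup_minus lookup_single when_def)
  qed
  moreover have "edge_binomial i j \<in> ?J" using e ij by (intro edge_binomial_mem) simp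
  ultimately show "ideal_gen B \<noteq> ?J" by blast
qed

section \<open>Dimensions of finitely spanned subspaces\<close>

context vector_space
begin

text \<open>The ambient space of sequences of polynomials is infinite-dimensional, so finiteness
  enters through the spanning set \<open>W\<close>. A basis \<open>B\<close> of the kernel is
  extended to a basis \<open>C\<close> of \<open>S\<close>, and \<open>f\<close> maps
  \<open>C - B\<close> to a basis of the image.\<close>

lemma rank_nullity_on:
  assumes f: "Vector_Spaces.linear scale scale f" and S: "subspace S" and W: "S \<subseteq> span W" "finite W"
  shows "dim S = dim {x \<in> S. f x = 0} + dim (f ` S)"
proof -
  interpret vector_space_pair scale scale by unfold_locales
  let ?N = "{x \<in> S. f x = 0}"
  obtain B where B: "B \<subseteq> ?N" "independent B" "?N \<subseteq> span B"
    by (rule maximal_independent_subset)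
  have "B \<subseteq> S" using B(1) by auto
  then obtain C where C: "B \<subseteq> C" "C \<subseteq> S" "independent C" "S \<subseteq> span C"
    by (rule maximal_independent_subset_extend[OF _ B(2)])
  have fin: "finite C"
    using independent_span_bound[OF W(2) C(3)] C(2) W(1) by auto
  have CS: "span C \<subseteq> S" using C(2) S by (rule span_minimal)
  have inj: "inj_on f (span (C - B))"
    unfolding linear_inj_on_iff_eq_0[OF f subspace_span]
  proof (intro ballI impI)
    fix x assume x: "x \<in> span (C - B)" "f x = 0"
    then have xB: "x \<in> span B" using CS span_mono[of "C - B" C] B(3) by blast
    \<comment> \<open>The coordinates of \<open>x\<close> are supported both on \<open>B\<close> and
      on \<open>C - B\<close>.\<close>
    have "representation C x b = 0" for b
      using representation_extend[OF C(3) x(1)] representation_extend[OF C(3) xB]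
        representation_ne_zero[of "C - B" x b] representation_ne_zero[of B x b] C(1)
      by fastforce
    moreover have "x \<in> span C" using xB span_mono[OF C(1)] by blast
    ultimately show "x = 0"
      using sum_nonzero_representation_eq[OF C(3), of x] by simp
  qed
  have ind: "independent (f ` (C - B))"
    by (rule linear_independent_injective_image[OF f _ inj])
      (use C(3) independent_mono in auto)
  have "span (f ` C) \<subseteq> span (f ` (C - B))"
  proof (rule span_minimal)
    show "f ` C \<subseteq> span (f ` (C - B))"
    proof
      fix y assume "y \<in> f ` C"
      then obtain c where "c \<in> C" "y = f c" by blast
      then show "y \<in> span (f ` (C - B))"
        using B(1) span_zero by (cases "c \<in> B") (auto intro: span_base dest!: subsetD[OF B(1)])
    qed
  qed simp
  then have "f ` S \<subseteq> span (f ` (C - B))"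
    using C(4) linear_span_image[OF f, of C] by blast
  moreover have "f ` (C - B) \<subseteq> f ` S" using C(2) by blast
  ultimately have "dim (f ` S) = card (f ` (C - B))"
    using basis_card_eq_dim ind by metis
  also have "\<dots> = card (C - B)"
    using inj by (intro card_image) (meson inj_on_subset span_superset)
  finally have "dim (f ` S) = card C - card B"
    using fin C(1) by (simp add: card_Diff_subset finite_subset)
  moreover have "dim ?N = card B" "dim S = card C"
    using basis_card_eq_dim B C by metis+
  moreover have "card B \<le> card C" using fin C(1) by (rule card_mono)
  ultimately show ?thesis by simp
qed

text \<open>A basis of \<open>T\<close> is extended to the whole space; the map kills it and fixes
  the remaining basis vectors.\<close>

lemma exists_linear_with_kernel:
  assumes T: "subspace T"
  shows "\<exists>g. Vector_Spaces.linear scale scale g \<and> {x. g x = 0} = T"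
proof -
  interpret vector_space_pair scale scale by unfold_locales
  obtain D where D: "D \<subseteq> T" "independent D" "T \<subseteq> span D"
    by (rule maximal_independent_subset)
  let ?B = "extend_basis D"
  obtain g where g: "Vector_Spaces.linear scale scale g" "\<forall>x\<in>?B. g x = (if x \<in> D then 0 else x)"
    using linear_independent_extend[OF independent_extend_basis[OF D(2)], of "\<lambda>x. if x \<in> D then 0 else x"]
    by blast
  have 1: "x - g x \<in> T" for x
  proof -
    have "x \<in> span ?B" using D(2) by simp
    then show ?thesis
    proof (induction rule: span_induct_alt)
      case base
      show ?case using linear_0[OF g(1)] subspace_0[OF T] by simp
    next
      case (step c x y)
      have "x - g x \<in> T" using g(2) step(1) D(1) subspace_0[OF T] by auto
      from subspace_add[OF T subspace_scale[OF T this, of c] step(2)]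
      show ?case
        by (simp add: linear_add[OF g(1)] linear_scale[OF g(1)] algebra_simps)
    qed
  qed
  have 2: "g x = 0" if "x \<in> T" for x
  proof -
    have "x \<in> span D" using that D(3) by blast
    then show ?thesis
      by (rule linear_eq_0_on_span[OF g(1), rotated])
        (use g(2) extend_basis_superset[OF D(2)] in auto)
  qed
  have "{x. g x = 0} = T"
    using 1 2 by (auto, metis diff_zero)
  with g(1) show ?thesis by blast
qed

text \<open>A linear map with kernel \<open>T\<close> has the same image on \<open>S\<close> as on
  the sum, with kernels \<open>S \<inter> T\<close> and \<open>T\<close>; rank-nullity is applied to
  both.\<close>

lemma dim_sum_inter:
  assumes S: "subspace S" "S \<subseteq> span W" and T: "subspace T" "T \<subseteq> span W" and W: "finite W"
  shows "dim {x + y | x y. x \<in> S \<and> y \<in> T} + dim (S \<inter> T) = dim S + dim T"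
proof -
  interpret vector_space_pair scale scale by unfold_locales
  obtain g where g: "Vector_Spaces.linear scale scale g" "{x. g x = 0} = T"
    using exists_linear_with_kernel[OF T(1)] by blast
  let ?U = "{x + y | x y. x \<in> S \<and> y \<in> T}"
  have "?U \<subseteq> span W" using S T by (auto intro: span_add)
  from rank_nullity_on[OF g(1) subspace_sums[OF S(1) T(1)] this W]
  have "dim ?U = dim {x \<in> ?U. g x = 0} + dim (g ` ?U)" .
  moreover have "{x \<in> ?U. g x = 0} = T"
    using g(2) subspace_0[OF S(1)] by (auto, metis add_0)
  moreover have "g ` ?U = g ` S"
  proof -
    have *: "g (x + y) = g x" if "y \<in> T" for x y using g that by (auto simp: linear_add[OF g(1)])
    have "x + 0 \<in> ?U" if "x \<in> S" for x using that subspace_0[OF T(1)] by blast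
    then show ?thesis using * by (auto simp: image_iff)
  qed
  moreover have "{x \<in> S. g x = 0} = S \<inter> T" using g(2) by auto
  ultimately show ?thesis
    using rank_nullity_on[OF g(1) S W] by simp
qed

lemma dim_subset_finite:
  assumes "S \<subseteq> T" "T \<subseteq> span W" "finite W"
  shows "dim S \<le> dim T"
proof -
  obtain B where B: "B \<subseteq> T" "independent B" "T \<subseteq> span B"
    by (rule maximal_independent_subset)
  moreover have "finite B"
    using independent_span_bound[OF assms(3) B(2)] B(1) assms(2) by auto
  ultimately show ?thesis
    using dim_le_card[of S B] basis_card_eq_dim[of B T] assms(1) by auto
qed

lemma dim_image_inj:
  assumes f: "Vector_Spaces.linear scale scale f" and S: "subspace S" "S \<subseteq> span W" "finite W"
    and inj: "\<And>x. f x = 0 \<Longrightarrow> x = 0"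
  shows "dim (f ` S) = dim S"
proof -
  interpret vector_space_pair scale scale by unfold_locales
  have "{x \<in> S. f x = 0} = span {}"
    using inj subspace_0[OF S(1)] linear_0[OF f] by auto
  then have "dim {x \<in> S. f x = 0} = 0"
    by (metis card.empty dim_span_eq_card_independent independent_empty)
  with rank_nullity_on[OF f S] show ?thesis by simp
qed

end

section \<open>Chains with coefficients in an ideal\<close>

interpretation kv: vector_space "kscale :: 'k::field \<Rightarrow> (nat \<Rightarrow> ('v, 'k) mpoly) \<Rightarrow> _"
  by (rule vector_space_kscale)

definition smul :: "'a::times \<Rightarrow> (nat \<Rightarrow> 'a) \<Rightarrow> nat \<Rightarrow> 'a" where
  "smul c w = (\<lambda>a. c * w a)"

lemma smul_apply [simp]: "smul c w a = c * w a"
  by (simp add: smul_def)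

lemma kscale_conv_smul: "kscale c = smul (Poly_Mapping.single 0 c)"
  by (simp add: kscale_def smul_def fun_eq_iff)

text \<open>The common form of differentials and homotopies. A map given by a matrix also acts on
  vectors with entries in an ideal, that is, after tensoring with it.\<close>

definition mat_map :: "nat \<Rightarrow> nat \<Rightarrow> (nat \<Rightarrow> nat \<Rightarrow> 'a::comm_ring_1) \<Rightarrow> (nat \<Rightarrow> 'a) \<Rightarrow> nat \<Rightarrow> 'a" where
  "mat_map m n H w = (\<lambda>a. if a < m then \<Sum>b<n. H a b * w b else 0)"

lemma diff_map_conv_mat_map:
  "diff_map P i = mat_map (res_rank P i) (res_rank P (Suc i)) (res_diff P i)"
  by (simp add: diff_map_def mat_map_def fun_eq_iff)

lemma mat_map_add: "mat_map m n H (w + z) = mat_map m n H w + mat_map m n H z"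
  by (simp add: mat_map_def fun_eq_iff distrib_left sum.distrib)

lemma mat_map_diff: "mat_map m n H (w - z) = mat_map m n H w - mat_map m n H z"
  by (simp add: mat_map_def fun_eq_iff right_diff_distrib sum_subtractf)

lemma mat_map_smul: "mat_map m n H (smul c w) = smul c (mat_map m n H w)"
  by (simp add: mat_map_def fun_eq_iff sum_distrib_left mult.left_commute)

lemma mat_map_zero [simp]: "mat_map m n H 0 = 0"
  by (simp add: mat_map_def fun_eq_iff)

lemma linear_mat_map: "Vector_Spaces.linear kscale kscale (mat_map m n H)"
  by (intro Vector_Spaces.linear_iff[THEN iffD2] conjI allI vector_space_kscale)
    (simp_all add: mat_map_add kscale_conv_smul mat_map_smul)

lemma linear_smul: "Vector_Spaces.linear kscale kscale (smul c)"
  by (intro Vector_Spaces.linear_iff[THEN iffD2] conjI allI vector_space_kscale)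
    (simp_all add: kscale_conv_smul fun_eq_iff algebra_simps)

lemma diff_map_add: "diff_map P i (w + z) = diff_map P i w + diff_map P i z"
  by (simp add: diff_map_conv_mat_map mat_map_add)

lemma diff_map_diff: "diff_map P i (w - z) = diff_map P i w - diff_map P i z"
  by (simp add: diff_map_conv_mat_map mat_map_diff)

lemma diff_map_smul: "diff_map P i (smul c w) = smul c (diff_map P i w)"
  by (simp add: diff_map_conv_mat_map mat_map_smul)

lemma linear_diff_map: "Vector_Spaces.linear kscale kscale (diff_map P i)"
  by (simp add: diff_map_conv_mat_map linear_mat_map)

lemma mat_map_mem:
  fixes L :: "('v, 'k::comm_ring_1) mpoly set"
  assumes L: "ideal.subspace L" and w: "\<And>b. b < n \<Longrightarrow> w b \<in> L"
  shows "mat_map m n H w a \<in> L"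
proof (cases "a < m")
  case True
  then show ?thesis
    unfolding mat_map_def
    by simp (intro ideal.subspace_sum[OF L] ideal.subspace_scale[OF L], use w in auto)
next
  case False
  then show ?thesis using ideal.subspace_0[OF L] by (simp add: mat_map_def)
qed

text \<open>The component of internal degree \<open>j\<close>. It commutes with the differentials
  and turns arbitrary preimages into homogeneous ones.\<close>

definition hcomp :: "('v, 'k::field) free_complex \<Rightarrow> nat \<Rightarrow> int \<Rightarrow> (nat \<Rightarrow> ('v, 'k) mpoly) \<Rightarrow> nat \<Rightarrow> ('v, 'k) mpoly" where
  "hcomp P i j w = (\<lambda>a. restr (\<lambda>m. int (mon_degree m) = j - res_shift P i a) (w a))"

text \<open>Graded ideals described by components instead of generators, the form in which
  homogeneity of chains is used.\<close>

definition hom_closed :: "('v, 'k::comm_ring_1) mpoly set \<Rightarrow> bool" where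
  "hom_closed L \<longleftrightarrow> ideal.subspace L \<and> (\<forall>p\<in>L. \<forall>d. restr (\<lambda>m. int (mon_degree m) = d) p \<in> L)"

lemma hom_closedD: "hom_closed L \<Longrightarrow> ideal.subspace L"
  by (simp add: hom_closed_def)

lemma hom_closed_ideal_gen:
  fixes S :: "('v::finite, 'k::comm_ring_1) mpoly set"
  assumes "\<And>s. s \<in> S \<Longrightarrow> homogeneous s"
  shows "hom_closed (ideal_gen S)"
proof -
  have "restr (\<lambda>m. int (mon_degree m) = d) p \<in> ideal_gen S" if "p \<in> ideal_gen S" for p d
    using that
    by (rule restr_in_ideal_gen[rotated 2])
      (use assms in \<open>auto simp: mon_degree_add homogeneous_def graded_piece_def\<close>)
  then show ?thesis by (simp add: hom_closed_def)
qed

lemma hom_closed_UNIV: "hom_closed UNIV"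
  by (simp add: hom_closed_def)

lemma restr_graded_piece: "restr (\<lambda>m. int (mon_degree m) = d) p \<in> graded_piece d"
  by (simp add: graded_piece_def keys_restr)

lemma restr_graded_piece_id: "p \<in> graded_piece d \<Longrightarrow> restr (\<lambda>m. int (mon_degree m) = d) p = p"
  by (rule restr_eq_self) (simp add: graded_piece_def)

lemma graded_piece_subset_restr: "p \<in> graded_piece d \<longleftrightarrow> restr (\<lambda>m. int (mon_degree m) = d) p = p"
  using restr_graded_piece restr_graded_piece_id by metis

lemma graded_piece_0 [simp]: "0 \<in> graded_piece d"
  by (simp add: graded_piece_def)

lemma graded_piece_add: "p \<in> graded_piece d \<Longrightarrow> q \<in> graded_piece d \<Longrightarrow> p + q \<in> graded_piece d"
  by (simp add: graded_piece_subset_restr restr_add)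

lemma restr_graded_piece_mult:
  fixes p q :: "('v::finite, 'k::comm_ring_1) mpoly"
  assumes "q \<in> graded_piece e"
  shows "restr (\<lambda>m. int (mon_degree m) = d) (q * p) = q * restr (\<lambda>m. int (mon_degree m) = d - e) p"
  by (rule restr_mult_homogeneous) (use assms in \<open>auto simp: graded_piece_def mon_degree_add\<close>)

lemma graded_piece_mult:
  fixes p q :: "('v::finite, 'k::comm_ring_1) mpoly"
  shows "p \<in> graded_piece d \<Longrightarrow> q \<in> graded_piece e \<Longrightarrow> p * q \<in> graded_piece (d + e)"
  by (simp add: graded_piece_subset_restr[of "p * q"] restr_graded_piece_mult restr_graded_piece_id)

lemma graded_piece_Var: "Var t \<in> (graded_piece 1 :: ('v, 'k::field) mpoly set)"
  by (simp add: graded_piece_def Var_def)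

lemma graded_piece_const: "Poly_Mapping.single 0 c \<in> graded_piece 0"
  by (simp add: graded_piece_def mon_degree_def)

lemma tor_chains_subspace:
  fixes L :: "('v::finite, 'k::field) mpoly set"
  assumes L: "ideal.subspace L"
  shows "kv.subspace (tor_chains P L i j)"
proof (rule kv.subspaceI, goal_cases)
  case (3 c w)
  then show ?case
    using graded_piece_mult[OF graded_piece_const[of c], where e = "j - res_shift P i a" for a]
    by (auto simp: tor_chains_def free_module_def kscale_def ideal.subspace_scale[OF L])
qed (auto simp: tor_chains_def free_module_def ideal.subspace_0[OF L] ideal.subspace_add[OF L] graded_piece_add)

lemma finite_monomials: "finite {m :: 'v::finite \<Rightarrow>\<^sub>0 nat. mon_degree m = d}"
proof -
  have "Poly_Mapping.lookup m v \<le> mon_degree m" for m :: "'v \<Rightarrow>\<^sub>0 nat" and v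
    by (cases "v \<in> Poly_Mapping.keys m")
      (auto simp: mon_degree_def in_keys_iff intro: member_le_sum)
  then have "Poly_Mapping.lookup ` {m :: 'v \<Rightarrow>\<^sub>0 nat. mon_degree m = d}
      \<subseteq> {f. \<forall>x. (x \<in> UNIV \<longrightarrow> f x \<in> {..d}) \<and> (x \<notin> UNIV \<longrightarrow> f x = 0)}"
    by auto
  then have "finite (Poly_Mapping.lookup ` {m :: 'v \<Rightarrow>\<^sub>0 nat. mon_degree m = d})"
    by (rule finite_subset) (intro finite_set_of_finite_funs, auto)
  moreover have "inj_on Poly_Mapping.lookup {m :: 'v \<Rightarrow>\<^sub>0 nat. mon_degree m = d}"
    by (metis inj_onI poly_mapping_eq_iff)
  ultimately show ?thesis
    using finite_imageD by blast
qed

text \<open>A single \<open>W\<close> serves all \<open>L\<close>, so that chains of different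
  ideals can be compared inside one finite-dimensional space.\<close>

lemma tor_chains_finite_span:
  "\<exists>W. finite W \<and> (\<forall>L. tor_chains P L i j \<subseteq> kv.span W)"
  for P :: "('v::finite, 'k::field) free_complex"
proof -
  define e where "e b m = (\<lambda>a. if a = b then Poly_Mapping.single m 1 else 0 :: ('v, 'k) mpoly)"
    for b :: nat and m
  \<comment> \<open>For a negative difference \<open>nat\<close> yields degree 0, which merely
    enlarges \<open>W\<close>.\<close>
  define M where "M b = {m :: 'v \<Rightarrow>\<^sub>0 nat. mon_degree m = nat (j - res_shift P i b)}" for b
  define W where "W = (\<Union>b<res_rank P i. e b ` M b)"
  have "finite W" unfolding W_def M_def using finite_monomials by blast
  moreover have "w \<in> kv.span W" if w: "w \<in> tor_chains P L i j" for L w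
  proof -
    have "w = (\<Sum>b<res_rank P i. \<Sum>m\<in>Poly_Mapping.keys (w b). kscale (Poly_Mapping.lookup (w b) m) (e b m))"
    proof
      fix a
      have sum_app: "(\<Sum>x\<in>A. f x) a = (\<Sum>x\<in>A. f x a)"
        for A :: "'c set" and f :: "'c \<Rightarrow> nat \<Rightarrow> ('v, 'k) mpoly"
        by (induction A rule: infinite_finite_induct) simp_all
      have "(\<Sum>b<res_rank P i. \<Sum>m\<in>Poly_Mapping.keys (w b). kscale (Poly_Mapping.lookup (w b) m) (e b m)) a
          = (\<Sum>b<res_rank P i. if b = a then w a else 0)"
        unfolding sum_app
      proof (rule sum.cong[OF refl])
        fix b
        show "(\<Sum>m\<in>Poly_Mapping.keys (w b). kscale (Poly_Mapping.lookup (w b) m) (e b m) a)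
            = (if b = a then w a else 0)"
          by (simp add: kscale_def e_def mult_single flip: poly_mapping_expand)
      qed
      also have "\<dots> = w a"
        using w by (auto simp: tor_chains_def free_module_def not_less)
      finally show "w a = (\<Sum>b<res_rank P i. \<Sum>m\<in>Poly_Mapping.keys (w b). kscale (Poly_Mapping.lookup (w b) m) (e b m)) a"
        by simp
    qed
    also have "\<dots> \<in> kv.span W"
    proof (intro kv.span_sum kv.span_scale kv.span_base)
      fix b m assume "b \<in> {..<res_rank P i}" "m \<in> Poly_Mapping.keys (w b)"
      moreover from this w have "int (mon_degree m) = j - res_shift P i b"
        by (auto simp: tor_chains_def graded_piece_def)
      then have "m \<in> M b" unfolding M_def by (metis mem_Collect_eq nat_int)
      ultimately show "e b m \<in> W" unfolding W_def by blast
    qed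
    finally show ?thesis .
  qed
  ultimately show ?thesis by blast
qed

locale resolution =
  fixes P :: "('v::finite, 'k::field) free_complex"
  assumes resolution: "graded_free_resolution P"
begin

lemma diff_homogeneous:
  "a < res_rank P i \<Longrightarrow> b < res_rank P (Suc i) \<Longrightarrow>
    res_diff P i a b \<in> graded_piece (res_shift P (Suc i) b - res_shift P i a)"
  using resolution by (simp add: graded_free_resolution_def)

lemma exact_0: "w \<in> free_module P 0 \<Longrightarrow> aug_map P w = 0 \<longleftrightarrow> w \<in> diff_map P 0 ` free_module P 1"
  using resolution unfolding graded_free_resolution_def by blast

lemma exact_Suc: "w \<in> free_module P (Suc i) \<Longrightarrow>
    diff_map P i w = 0 \<longleftrightarrow> w \<in> diff_map P (Suc i) ` free_module P (Suc (Suc i))"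
  using resolution unfolding graded_free_resolution_def by blast

lemma diff_map_free: "diff_map P i w \<in> free_module P i"
  by (simp add: diff_map_def free_module_def)

lemma diff_diff: "w \<in> free_module P (Suc (Suc i)) \<Longrightarrow> diff_map P i (diff_map P (Suc i) w) = 0"
  using exact_Suc[OF diff_map_free] by blast

lemma diff_map_hcomp: "diff_map P i (hcomp P (Suc i) j w) = hcomp P i j (diff_map P i w)"
proof
  fix a
  show "diff_map P i (hcomp P (Suc i) j w) a = hcomp P i j (diff_map P i w) a"
  proof (cases "a < res_rank P i")
    case True
    have "restr (\<lambda>m. int (mon_degree m) = j - res_shift P i a) (res_diff P i a b * w b)
        = res_diff P i a b * restr (\<lambda>m. int (mon_degree m) = j - res_shift P (Suc i) b) (w b)"
      if "b < res_rank P (Suc i)" for b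
      using restr_graded_piece_mult[OF diff_homogeneous[OF True that],
          of "j - res_shift P i a" "w b"] by simp
    with True show ?thesis by (simp add: diff_map_def hcomp_def restr_sum)
  qed (simp add: diff_map_def hcomp_def)
qed

lemma hcomp_chain:
  assumes "hom_closed L" "w \<in> free_module P i" "\<And>a. a < res_rank P i \<Longrightarrow> w a \<in> L"
  shows "hcomp P i j w \<in> tor_chains P L i j"
  using assms by (auto simp: hcomp_def tor_chains_def free_module_def hom_closed_def restr_graded_piece)

lemma hcomp_id: "w \<in> tor_chains P L i j \<Longrightarrow> hcomp P i j w = w"
proof
  fix a assume w: "w \<in> tor_chains P L i j"
  show "hcomp P i j w a = w a"
  proof (cases "a < res_rank P i")
    case True
    with w show ?thesis by (simp add: hcomp_def tor_chains_def restr_graded_piece_id)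
  next
    case False
    with w show ?thesis by (simp add: hcomp_def tor_chains_def free_module_def)
  qed
qed

lemma diff_map_chain:
  assumes L: "ideal.subspace L" and w: "w \<in> tor_chains P L (Suc i) j"
  shows "diff_map P i w \<in> tor_chains P L i j"
proof -
  have "diff_map P i w a \<in> L" for a
    unfolding diff_map_conv_mat_map by (rule mat_map_mem[OF L]) (use w in \<open>auto simp: tor_chains_def\<close>)
  moreover have "diff_map P i w = hcomp P i j (diff_map P i w)"
    by (metis diff_map_hcomp hcomp_id[OF w])
  then have "diff_map P i w a \<in> graded_piece (j - res_shift P i a)" for a
    by (metis hcomp_def restr_graded_piece)
  ultimately show ?thesis
    using diff_map_free by (simp add: tor_chains_def)
qed

text \<open>The preimage \<open>y\<close> may be inhomogeneous; as \<open>w\<close> has degree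
  \<open>j\<close>, the component of \<open>y\<close> in that degree is again a preimage.\<close>

lemma boundaryI:
  assumes L: "hom_closed L" and w: "w \<in> tor_chains P L' i j"
    and y: "y \<in> free_module P (Suc i)" "\<And>a. a < res_rank P (Suc i) \<Longrightarrow> y a \<in> L" "w = diff_map P i y"
  shows "w \<in> tor_boundaries P L i j"
proof -
  have "w = diff_map P i (hcomp P (Suc i) j y)"
    using y(3) hcomp_id[OF w] by (simp add: diff_map_hcomp)
  with hcomp_chain[OF L y(1,2), of j] show ?thesis by (auto simp: tor_boundaries_def)
qed

text \<open>Exactness of the augmented complex; at \<open>i = 0\<close> the augmentation takes the
  place of the previous differential.\<close>

lemma cycles_UNIV_boundary:
  assumes w: "w \<in> tor_cycles P UNIV i j" and 0: "i = 0 \<Longrightarrow> aug_map P w = 0"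
  shows "w \<in> tor_boundaries P UNIV i j"
proof -
  have free: "w \<in> free_module P i" and chain: "w \<in> tor_chains P UNIV i j"
    using w by (auto simp: tor_cycles_def tor_chains_def)
  have "w \<in> diff_map P i ` free_module P (Suc i)"
  proof (cases i)
    case 0
    then show ?thesis using exact_0 assms(2) free by simp
  next
    case (Suc k)
    then show ?thesis using exact_Suc[of w k] w free by (simp add: tor_cycles_def)
  qed
  then show ?thesis using boundaryI[OF hom_closed_UNIV chain] by blast
qed

subsection \<open>Variables annihilate Tor\<close>

text \<open>Projectivity of free modules: preimages of the values of \<open>G\<close> on the basis
  are the columns of the matrix.\<close>

lemma exists_matrix_lift:
  assumes add: "\<And>w z. G (w + z) = G w + G z" and smul: "\<And>c w. G (smul c w) = smul c (G w)"
    and im: "\<And>w. w \<in> free_module P k \<Longrightarrow> G w \<in> diff_map P i ` free_module P (Suc i)"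
  shows "\<exists>H. \<forall>w\<in>free_module P k. G w = diff_map P i (mat_map (res_rank P (Suc i)) (res_rank P k) H w)"
proof -
  define e where "e b = (\<lambda>a. if a = b then 1 else 0 :: ('v, 'k) mpoly)" for b :: nat
  have "\<exists>h. h \<in> free_module P (Suc i) \<and> (b < res_rank P k \<longrightarrow> G (e b) = diff_map P i h)" for b
  proof (cases "b < res_rank P k")
    case True
    then have "e b \<in> free_module P k" by (auto simp: e_def free_module_def)
    from im[OF this] show ?thesis by blast
  next
    case False
    then show ?thesis by (intro exI[of _ 0]) (simp add: free_module_def)
  qed
  then obtain h where h: "\<And>b. h b \<in> free_module P (Suc i)"
    "\<And>b. b < res_rank P k \<Longrightarrow> G (e b) = diff_map P i (h b)" by metis
  let ?H = "\<lambda>a b. h b a"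
  have sum_app: "(\<Sum>x\<in>A. f x) a = (\<Sum>x\<in>A. f x a)"
    for A :: "nat set" and f :: "nat \<Rightarrow> nat \<Rightarrow> ('v, 'k) mpoly" and a
    by (induction A rule: infinite_finite_induct) simp_all
  have zero: "G 0 = 0" using add[of 0 0] by simp
  have "G w = diff_map P i (mat_map (res_rank P (Suc i)) (res_rank P k) ?H w)"
    if w: "w \<in> free_module P k" for w
  proof -
    have w_eq: "w = (\<Sum>b<res_rank P k. smul (w b) (e b))"
      using w by (auto simp: fun_eq_iff sum_app e_def free_module_def if_distrib not_less cong: if_cong)
    have "G (\<Sum>b\<in>A. smul (w b) (e b)) = diff_map P i (\<Sum>b\<in>A. smul (w b) (h b))"
      if "A \<subseteq> {..<res_rank P k}" "finite A" for A
      using that(2,1)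
    proof induction
      case empty
      have "diff_map P i 0 = 0" using diff_map_add[of P i 0 0] by simp
      then show ?case by (simp only: sum.empty zero)
    next
      case (insert b A)
      then have b: "b < res_rank P k" and IH: "G (\<Sum>b\<in>A. smul (w b) (e b)) = diff_map P i (\<Sum>b\<in>A. smul (w b) (h b))"
        using insert.prems by simp (rule insert.IH, use insert.prems in simp)
      show ?case
        by (simp only: sum.insert[OF insert(1,2)] add smul h(2)[OF b] diff_map_add diff_map_smul IH)
    qed
    from this[of "{..<res_rank P k}"] w_eq have "G w = diff_map P i (\<Sum>b<res_rank P k. smul (w b) (h b))"
      by simp
    also have "(\<Sum>b<res_rank P k. smul (w b) (h b)) = mat_map (res_rank P (Suc i)) (res_rank P k) ?H w"
      using h(1) by (auto simp: fun_eq_iff sum_app mat_map_def free_module_def mult.commute)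
    finally show ?thesis .
  qed
  then show ?thesis by blast
qed

text \<open>Multiplication by a variable lifts the zero map of \<open>k\<close>, hence is null-homotopic on \<open>P\<close>.\<close>

lemma exists_homotopy:
  "\<exists>H H'. \<forall>w\<in>free_module P i. smul (Var t) w =
      diff_map P i (mat_map (res_rank P (Suc i)) (res_rank P i) H w) +
      (if i = 0 then 0 else mat_map (res_rank P i) (res_rank P (i - 1)) H' (diff_map P (i - 1) w))"
proof (induction i)
  case 0
  have "\<exists>H. \<forall>w\<in>free_module P 0. smul (Var t) w = diff_map P 0 (mat_map (res_rank P (Suc 0)) (res_rank P 0) H w)"
  proof (rule exists_matrix_lift)
    fix w assume w: "w \<in> free_module P 0"
    have "Poly_Mapping.lookup (Var t * p) 0 = 0" for p :: "('v, 'k) mpoly"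
    proof (rule ccontr)
      assume "Poly_Mapping.lookup (Var t * p) 0 \<noteq> 0"
      then have "0 \<in> (+) (Poly_Mapping.single t 1) ` Poly_Mapping.keys p"
        by (simp only: in_keys_iff not_False_eq_True flip: keys_Var_mult)
      then obtain m :: "'v \<Rightarrow>\<^sub>0 nat" where "0 = Poly_Mapping.single t 1 + m" by blast
      from arg_cong[OF this, of "\<lambda>m. Poly_Mapping.lookup m t"] show False by (simp add: lookup_add)
    qed
    then have "aug_map P (smul (Var t) w) = 0" by (simp add: aug_map_def)
    with w show "smul (Var t) w \<in> diff_map P 0 ` free_module P (Suc 0)"
      using exact_0[of "smul (Var t) w"] by (simp add: free_module_def)
  qed (simp_all add: fun_eq_iff algebra_simps)
  then show ?case by (simp only: refl if_True add_0_right simp_thms)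
next
  case (Suc i)
  then obtain H H' where H: "\<And>w. w \<in> free_module P i \<Longrightarrow> smul (Var t) w =
      diff_map P i (mat_map (res_rank P (Suc i)) (res_rank P i) H w) +
      (if i = 0 then 0 else mat_map (res_rank P i) (res_rank P (i - 1)) H' (diff_map P (i - 1) w))"
    by blast
  let ?h = "mat_map (res_rank P (Suc i)) (res_rank P i) H"
  \<comment> \<open>What remains of the multiplication after the homotopy of the previous degree;
    its values are cycles, so it lifts by exactness.\<close>
  define G where "G w = smul (Var t) w - ?h (diff_map P i w)" for w
  have "\<exists>K. \<forall>w\<in>free_module P (Suc i).
      G w = diff_map P (Suc i) (mat_map (res_rank P (Suc (Suc i))) (res_rank P (Suc i)) K w)"
  proof (rule exists_matrix_lift)
    fix w assume w: "w \<in> free_module P (Suc i)"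
    have 0: "(if i = 0 then 0 else mat_map (res_rank P i) (res_rank P (i - 1)) H' (diff_map P (i - 1) (diff_map P i w))) = 0"
      using diff_diff[of w "i - 1"] w by (cases i) simp_all
    have "diff_map P i (G w) = 0"
      using H[OF diff_map_free, of w] unfolding 0 G_def diff_map_diff diff_map_smul by simp
    moreover have "G w \<in> free_module P (Suc i)"
      using w by (simp add: G_def free_module_def mat_map_def)
    ultimately show "G w \<in> diff_map P (Suc i) ` free_module P (Suc (Suc i))"
      using exact_Suc by blast
  qed (simp_all add: G_def diff_map_add diff_map_smul mat_map_add mat_map_smul fun_eq_iff algebra_simps)
  then obtain K where "\<And>w. w \<in> free_module P (Suc i) \<Longrightarrow>
      G w = diff_map P (Suc i) (mat_map (res_rank P (Suc (Suc i))) (res_rank P (Suc i)) K w)"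
    by blast
  then show ?case
    by (intro exI[of _ K] exI[of _ H]) (simp add: G_def diff_eq_eq)
qed

text \<open>On a cycle the second term of the homotopy vanishes, and the matrix \<open>H\<close>
  keeps entries in \<open>L\<close>.\<close>

lemma Var_smul_boundary:
  assumes L: "hom_closed L" and w: "w \<in> tor_cycles P L i (j - 1)"
  shows "smul (Var t) w \<in> tor_boundaries P L i j"
proof -
  have free: "w \<in> free_module P i" and mem: "\<And>a. a < res_rank P i \<Longrightarrow> w a \<in> L"
    and deg: "\<And>a. a < res_rank P i \<Longrightarrow> w a \<in> graded_piece (j - 1 - res_shift P i a)"
    and cycle: "i = 0 \<or> diff_map P (i - 1) w = 0"
    using w by (auto simp: tor_cycles_def tor_chains_def)
  obtain H H' where H: "smul (Var t) w =
      diff_map P i (mat_map (res_rank P (Suc i)) (res_rank P i) H w) +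
      (if i = 0 then 0 else mat_map (res_rank P i) (res_rank P (i - 1)) H' (diff_map P (i - 1) w))"
    using exists_homotopy[of i t] free by blast
  have eq: "smul (Var t) w = diff_map P i (mat_map (res_rank P (Suc i)) (res_rank P i) H w)"
    using cycle unfolding H by auto
  have "smul (Var t) w \<in> tor_chains P L i j"
    using graded_piece_mult[OF graded_piece_Var[of t] deg] free mem
    by (auto simp: tor_chains_def free_module_def ideal.subspace_scale[OF hom_closedD[OF L]] add.commute
        add_diff_eq)
  then show ?thesis
  proof (rule boundaryI[OF L _ _ _ eq])
    show "mat_map (res_rank P (Suc i)) (res_rank P i) H w a \<in> L" for a
      by (rule mat_map_mem[OF hom_closedD[OF L] mem])
  qed (simp add: free_module_def mat_map_def)
qed

end

section \<open>The Koszul resolution\<close>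

text \<open>\<open>pr1\<close>, \<open>pr2\<close> and \<open>join\<close> are the coordinates of a
  direct sum: indices below \<open>n\<close> form the first summand, and the others are shifted down
  by \<open>n\<close>.\<close>

definition pr1 :: "nat \<Rightarrow> (nat \<Rightarrow> 'a::zero) \<Rightarrow> nat \<Rightarrow> 'a" where
  "pr1 n w = (\<lambda>a. if a < n then w a else 0)"

definition pr2 :: "nat \<Rightarrow> (nat \<Rightarrow> 'a) \<Rightarrow> nat \<Rightarrow> 'a" where
  "pr2 n w = (\<lambda>a. w (n + a))"

definition join :: "nat \<Rightarrow> (nat \<Rightarrow> 'a) \<Rightarrow> (nat \<Rightarrow> 'a) \<Rightarrow> nat \<Rightarrow> 'a" where
  "join n w z = (\<lambda>a. if a < n then w a else z (a - n))"

lemma join_pr: "join n (pr1 n w) (pr2 n w) = w"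
  by (auto simp: join_def pr1_def pr2_def)

lemma pr2_join [simp]: "pr2 n (join n w z) = z"
  by (auto simp: join_def pr2_def)

lemma pr1_join [simp]: "(\<And>a. a \<ge> n \<Longrightarrow> w a = 0) \<Longrightarrow> pr1 n (join n w z) = w"
  by (auto simp: join_def pr1_def)

text \<open>
  The mapping cone of multiplication by \<open>x\<close>: in degree \<open>i\<close>, the first \<open>res_rank P i\<close> indices belong
  to \<open>P\<^sub>i\<close> and the remaining ones to \<open>P\<^sub>i\<^sub>-\<^sub>1(-1)\<close>. For \<open>i = 0\<close> the truncated \<open>i - 1\<close> is never used.
\<close>

definition cone :: "'v \<Rightarrow> ('v, 'k::field) free_complex \<Rightarrow> ('v, 'k) free_complex" where
  "cone x P = \<lparr>
    res_rank = (\<lambda>i. res_rank P i + (case i of 0 \<Rightarrow> 0 | Suc k \<Rightarrow> res_rank P k)),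
    res_shift = (\<lambda>i a. if a < res_rank P i then res_shift P i a
      else res_shift P (i - 1) (a - res_rank P i) + 1),
    res_diff = (\<lambda>i a b.
      if a < res_rank P i then
        (if b < res_rank P (Suc i) then res_diff P i a b
         else if a = b - res_rank P (Suc i) then Var x else 0)
      else
        (if b < res_rank P (Suc i) then 0
         else - res_diff P (i - 1) (a - res_rank P i) (b - res_rank P (Suc i)))),
    res_aug = res_aug P\<rparr>"

lemma res_rank_cone:
  "res_rank (cone x P) 0 = res_rank P 0"
  "res_rank (cone x P) (Suc i) = res_rank P (Suc i) + res_rank P i"
  by (simp_all add: cone_def)

lemma sum_lessThan_add: "(\<Sum>b<m + n. f b) = (\<Sum>b<m. f b) + (\<Sum>b<n. f (m + b))" for m n :: nat
  by (induction n) (simp_all add: add.assoc)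

lemma diff_map_cone:
  "diff_map (cone x P) i w = join (res_rank P i)
    (diff_map P i (pr1 (res_rank P (Suc i)) w) + smul (Var x) (pr2 (res_rank P (Suc i)) w))
    (case i of 0 \<Rightarrow> 0 | Suc k \<Rightarrow> - diff_map P k (pr2 (res_rank P (Suc i)) w))"
proof
  fix a
  let ?r = "res_rank P (Suc i)"
  consider "a < res_rank P i" | "a \<ge> res_rank (cone x P) i" "a \<ge> res_rank P i"
    | k where "i = Suc k" "a \<ge> res_rank P i" "a < res_rank P i + res_rank P k"
    by (cases i) (force simp: res_rank_cone)+
  then show "diff_map (cone x P) i w a = join (res_rank P i)
    (diff_map P i (pr1 ?r w) + smul (Var x) (pr2 ?r w))
    (case i of 0 \<Rightarrow> 0 | Suc k \<Rightarrow> - diff_map P k (pr2 ?r w)) a"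
  proof cases
    case 1
    then have a: "a < res_rank (cone x P) i" by (cases i) (simp_all add: res_rank_cone)
    have "diff_map (cone x P) i w a = (\<Sum>b<?r. res_diff P i a b * w b)
        + (\<Sum>b<res_rank P i. (if a = b then Var x else 0) * w (?r + b))"
      using 1 a by (simp add: diff_map_def res_rank_cone sum_lessThan_add) (simp add: cone_def)
    also have "(\<Sum>b<res_rank P i. (if a = b then Var x else 0) * w (?r + b)) = Var x * w (?r + a)"
      using 1 by (simp add: if_distrib[of "\<lambda>c. c * _"] cong: if_cong)
    finally show ?thesis
      using 1 by (simp add: join_def diff_map_def pr1_def pr2_def)
  next
    case 2
    then show ?thesis
      by (cases i) (auto simp: diff_map_def join_def res_rank_cone)
  next
    case (3 k)
    then have a: "a < res_rank (cone x P) i" "a - res_rank P i < res_rank P k"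
      by (auto simp: res_rank_cone)
    have "diff_map (cone x P) i w a = (\<Sum>b<res_rank P i. - res_diff P k (a - res_rank P i) b * w (?r + b))"
      using 3 a(1) by (simp add: diff_map_def res_rank_cone sum_lessThan_add) (simp add: cone_def)
    also have "\<dots> = - diff_map P k (pr2 ?r w) (a - res_rank P i)"
      using a(2) 3 by (simp add: diff_map_def pr2_def sum_negf)
    finally show ?thesis
      using 3 by (simp add: join_def)
  qed
qed

text \<open>A free resolution of the quotient by the variables in \<open>S\<close>; membership in
  their ideal is expressed by each monomial involving one of them.\<close>

definition partial_koszul :: "'v set \<Rightarrow> ('v, 'k::field) free_complex \<Rightarrow> bool" where
  "partial_koszul S P \<longleftrightarrow>
     (\<forall>i. \<forall>a<res_rank P i. \<forall>b<res_rank P (Suc i).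
        res_diff P i a b \<in> graded_piece (res_shift P (Suc i) b - res_shift P i a)) \<and>
     res_rank P 0 = 1 \<and> res_shift P 0 0 = 0 \<and> res_aug P 0 = 1 \<and>
     diff_map P 0 ` free_module P 1 =
       {w \<in> free_module P 0. \<forall>m\<in>Poly_Mapping.keys (w 0). \<exists>t\<in>S. Poly_Mapping.lookup m t > 0} \<and>
     (\<forall>i. {w \<in> free_module P (Suc i). diff_map P i w = 0}
            = diff_map P (Suc i) ` free_module P (Suc (Suc i)))"

lemma partial_koszul_empty: "\<exists>P :: ('v, 'k::field) free_complex. partial_koszul {} P"
proof -
  let ?P = "\<lparr>res_rank = (\<lambda>i. if i = 0 then 1 else 0), res_shift = (\<lambda>i a. 0),
    res_diff = (\<lambda>i a b. 0), res_aug = (\<lambda>a. 1)\<rparr> :: ('v, 'k) free_complex"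
  have free: "free_module ?P (Suc i) = {0}" for i
    by (auto simp: free_module_def fun_eq_iff)
  have "diff_map ?P i = (\<lambda>w. 0)" for i
    by (auto simp: diff_map_def fun_eq_iff)
  moreover have "{w \<in> free_module ?P 0. \<forall>m\<in>Poly_Mapping.keys (w 0). \<exists>t\<in>{}. Poly_Mapping.lookup m t > 0} = {0}"
  proof -
    have "w = 0 \<longleftrightarrow> Poly_Mapping.keys (w 0) = {}" if "w \<in> free_module ?P 0" for w
    proof
      assume "Poly_Mapping.keys (w 0) = {}"
      then have "w 0 = 0" by simp
      then have "w a = 0" for a using that by (cases a) (auto simp: free_module_def)
      then show "w = 0" by (simp add: fun_eq_iff)
    qed simp
    then show ?thesis by (auto simp: free_module_def)
  qed
  ultimately have "partial_koszul {} ?P"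
    unfolding partial_koszul_def using free by simp
  then show ?thesis ..
qed

lemma diff_map_uminus: "diff_map P i (- w) = - diff_map P i w"
  by (simp add: diff_map_def fun_eq_iff sum_negf)

text \<open>The cone of multiplication by \<open>x\<close> resolves the quotient by one more
  variable because \<open>x\<close> is regular modulo the variables in \<open>S\<close>.\<close>

lemma partial_koszul_cone:
  fixes P :: "('v, 'k::field) free_complex"
  assumes P: "partial_koszul S P" and x: "x \<notin> S"
  shows "partial_koszul (insert x S) (cone x P)"
proof -
  let ?P = "cone x P" and ?r = "res_rank P"
  have rank0: "?r 0 = 1" "res_shift P 0 0 = 0" "res_aug P 0 = 1"
    and hom: "\<And>i a b. a < ?r i \<Longrightarrow> b < ?r (Suc i) \<Longrightarrow>
        res_diff P i a b \<in> graded_piece (res_shift P (Suc i) b - res_shift P i a)"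
    and im: "diff_map P 0 ` free_module P 1 =
       {w \<in> free_module P 0. \<forall>m\<in>Poly_Mapping.keys (w 0). \<exists>t\<in>S. Poly_Mapping.lookup m t > 0}"
    and ex: "\<And>i. {w \<in> free_module P (Suc i). diff_map P i w = 0}
            = diff_map P (Suc i) ` free_module P (Suc (Suc i))"
    using P by (auto simp: partial_koszul_def)
  have free_join: "join (?r (Suc i)) y z \<in> free_module ?P (Suc i)"
    if "z \<in> free_module P i" for i y z
    using that by (auto simp: free_module_def join_def res_rank_cone)
  have free_pr1: "pr1 (?r (Suc i)) w \<in> free_module P (Suc i)" for i w
    by (auto simp: free_module_def pr1_def)
  have free_pr2: "pr2 (?r (Suc i)) w \<in> free_module P i" if "w \<in> free_module ?P (Suc i)" for i w
    using that by (auto simp: free_module_def pr2_def res_rank_cone)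
  have dfree: "diff_map Q i w \<in> free_module Q i" for Q :: "('v, 'k) free_complex" and i w
    by (simp add: free_module_def diff_map_def)
  have dd: "diff_map P i (diff_map P (Suc i) w) = 0" if "w \<in> free_module P (Suc (Suc i))" for i w
    using ex[of i] that by blast
  have freeD: "w a = 0" if "w \<in> free_module P i" "a \<ge> ?r i" for w i a
    using that by (simp add: free_module_def)
  have d_join: "diff_map ?P i (join (?r (Suc i)) y z) = join (?r i) (diff_map P i y + smul (Var x) z)
      (case i of 0 \<Rightarrow> 0 | Suc k \<Rightarrow> - diff_map P k z)"
    if "y \<in> free_module P (Suc i)" for i y z
    unfolding diff_map_cone pr2_join using freeD[OF that] by simp

  have "res_diff ?P i a b \<in> graded_piece (res_shift ?P (Suc i) b - res_shift ?P i a)"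
    if ab: "a < res_rank ?P i" "b < res_rank ?P (Suc i)" for i a b
  proof (cases "a < ?r i")
    case True
    then show ?thesis using hom[OF True, of b] graded_piece_Var[of x, where ?'k = 'k] by (simp add: cone_def)
  next
    case False
    with ab obtain k where i: "i = Suc k" by (cases i) (auto simp: res_rank_cone)
    with False ab have "a - ?r i < ?r k" "\<not> b < ?r (Suc i) \<Longrightarrow> b - ?r (Suc i) < ?r i"
      by (auto simp: res_rank_cone)
    with False hom[of "a - ?r i" k "b - ?r (Suc i)"] i show ?thesis
      by (auto simp: cone_def graded_piece_def)
  qed
  moreover have "diff_map ?P 0 ` free_module ?P 1 =
       {w \<in> free_module ?P 0. \<forall>m\<in>Poly_Mapping.keys (w 0). \<exists>t\<in>insert x S. Poly_Mapping.lookup m t > 0}"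
    (is "?lhs = ?rhs")
  proof
    show "?lhs \<subseteq> ?rhs"
    proof
      fix w assume "w \<in> ?lhs"
      then obtain w' where w': "w = diff_map ?P 0 w'" by blast
      let ?y = "diff_map P 0 (pr1 (?r (Suc 0)) w')" and ?z = "pr2 (?r (Suc 0)) w'"
      have "w 0 = ?y 0 + Var x * ?z 0"
        unfolding w' diff_map_cone by (simp add: join_def rank0)
      moreover have "?y \<in> diff_map P 0 ` free_module P 1" using free_pr1[of 0] by simp
      then have "\<forall>m\<in>Poly_Mapping.keys (?y 0). \<exists>t\<in>S. Poly_Mapping.lookup m t > 0"
        unfolding im by blast
      moreover have "\<forall>m\<in>Poly_Mapping.keys (Var x * ?z 0). Poly_Mapping.lookup m x > 0"
        unfolding keys_Var_mult by (auto simp: lookup_add)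
      ultimately have "\<forall>m\<in>Poly_Mapping.keys (w 0). \<exists>t\<in>insert x S. Poly_Mapping.lookup m t > 0"
        using Poly_Mapping.keys_add[of "?y 0" "Var x * ?z 0"] by fastforce
      then show "w \<in> ?rhs" unfolding w' using dfree by blast
    qed
    show "?rhs \<subseteq> ?lhs"
    proof
      fix w assume w: "w \<in> ?rhs"
      let ?Q = "\<lambda>m. \<exists>t\<in>S. Poly_Mapping.lookup m t > 0"
      let ?p = "restr ?Q (w 0)"
      have w0: "w a = 0" if "a > 0" for a
        using w that by (auto simp: free_module_def res_rank_cone rank0)
      \<comment> \<open>The monomials free of variables from \<open>S\<close> must involve
        \<open>x\<close>. The factor 1 fits the shape of \<open>mult_mem_of_vars\<close>.\<close>
      have "(w 0 - ?p) * 1 \<in> ideal_gen {Var x}"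
      proof (rule mult_mem_of_vars[where T = "{x}"])
        fix m assume "m \<in> Poly_Mapping.keys (w 0 - ?p)"
        then have "m \<in> Poly_Mapping.keys (w 0)" "\<not> ?Q m"
          by (auto simp: in_keys_iff lookup_minus lookup_restr split: if_splits)
        with w show "\<exists>t\<in>{x}. 0 < Poly_Mapping.lookup m t" by auto
      qed (auto intro: ideal_gen_base)
      then obtain q where q: "w 0 - ?p = q * Var x"
        unfolding ideal_gen_singleton by auto
      let ?y = "\<lambda>a::nat. if a = 0 then ?p else 0" and ?z = "\<lambda>a::nat. if a = 0 then q else 0"
      have "?y \<in> diff_map P 0 ` free_module P 1"
        unfolding im by (auto simp: free_module_def rank0 keys_restr)
      then obtain y where y: "y \<in> free_module P (Suc 0)" "?y = diff_map P 0 y" by auto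
      have z: "?z \<in> free_module P 0" by (auto simp: free_module_def rank0)
      have "w = diff_map ?P 0 (join (?r (Suc 0)) y ?z)"
      proof
        fix a
        show "w a = diff_map ?P 0 (join (?r (Suc 0)) y ?z) a"
          unfolding d_join[OF y(1)] y(2)[symmetric]
          using q w0 by (cases "a = 0") (auto simp: join_def rank0 algebra_simps)
      qed
      with free_join[OF z, of y] show "w \<in> ?lhs" by auto
    qed
  qed
  moreover have "{w \<in> free_module ?P (Suc i). diff_map ?P i w = 0}
            = diff_map ?P (Suc i) ` free_module ?P (Suc (Suc i))" for i
  proof (intro subset_antisym subsetI)
    fix w assume "w \<in> {w \<in> free_module ?P (Suc i). diff_map ?P i w = 0}"
    then have w: "w \<in> free_module ?P (Suc i)" "diff_map ?P i w = 0" by auto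
    define y z where "y = pr1 (?r (Suc i)) w" and "z = pr2 (?r (Suc i)) w"
    have y: "y \<in> free_module P (Suc i)" and z: "z \<in> free_module P i"
      unfolding y_def z_def by (rule free_pr1, rule free_pr2[OF w(1)])
    have wj: "w = join (?r (Suc i)) y z" by (simp add: y_def z_def join_pr)
    have d0: "join (?r i) (diff_map P i y + smul (Var x) z) (case i of 0 \<Rightarrow> 0 | Suc k \<Rightarrow> - diff_map P k z) = 0"
      using w(2) unfolding wj d_join[OF y] .
    have dyz: "diff_map P i y + smul (Var x) z = 0"
    proof
      fix a
      show "(diff_map P i y + smul (Var x) z) a = 0 a"
        using fun_cong[OF d0, of a] freeD[OF dfree, of i a] freeD[OF z, of a]
        by (cases "a < ?r i") (auto simp: join_def)
    qed
    \<comment> \<open>For \<open>i = 0\<close> this is regularity of \<open>x\<close>: a variable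
      \<open>t \<in> S\<close> dividing \<open>x\<close> times a monomial differs from
      \<open>x\<close> and divides the monomial. For larger \<open>i\<close> the second block of the
      differential makes \<open>z\<close> a cycle.\<close>
    have "z \<in> diff_map P i ` free_module P (Suc i)"
    proof (cases i)
      case 0
      have "diff_map P 0 (- y) = smul (Var x) z"
        using dyz 0 by (simp add: diff_map_uminus minus_unique)
      moreover have "- y \<in> free_module P 1" using y 0 by (auto simp: free_module_def)
      ultimately have "smul (Var x) z \<in> diff_map P 0 ` free_module P 1"
        by (metis imageI)
      then have *: "\<forall>m\<in>Poly_Mapping.keys (Var x * z 0). \<exists>t\<in>S. Poly_Mapping.lookup m t > 0"
        unfolding im by simp
      have "\<exists>t\<in>S. Poly_Mapping.lookup m t > 0" if "m \<in> Poly_Mapping.keys (z 0)" for m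
      proof -
        from that * obtain t where t: "t \<in> S" "Poly_Mapping.lookup (Poly_Mapping.single x 1 + m) t > 0"
          unfolding keys_Var_mult by blast
        with x have "Poly_Mapping.lookup m t > 0"
          by (auto simp: lookup_add lookup_single when_def split: if_splits)
        with t(1) show ?thesis by blast
      qed
      with z have "z \<in> diff_map P 0 ` free_module P 1" unfolding im 0 by blast
      then show ?thesis by (simp add: 0)
    next
      case (Suc k)
      have "(diff_map P k z) a = 0" for a
        using fun_cong[OF d0, of "?r i + a"] Suc by (auto simp: join_def)
      then have "diff_map P k z = 0" by (simp add: fun_eq_iff)
      then show ?thesis using ex[of k] z Suc by blast
    qed
    then obtain z' where z': "z' \<in> free_module P (Suc i)" "z = diff_map P i z'" by blast
    \<comment> \<open>Adding \<open>x z'\<close> corrects \<open>y\<close> to a cycle, with a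
      preimage \<open>w'\<close>. The cone then sends \<open>(w', -z')\<close> to
      \<open>(y, z)\<close>, the sign cancelling the one in its second block.\<close>
    have "diff_map P i (y + smul (Var x) z') = 0"
      using dyz unfolding diff_map_add diff_map_smul z'(2) .
    moreover have "y + smul (Var x) z' \<in> free_module P (Suc i)"
      using y z'(1) by (simp add: free_module_def)
    ultimately obtain w' where w': "w' \<in> free_module P (Suc (Suc i))"
      "y + smul (Var x) z' = diff_map P (Suc i) w'"
      using ex[of i] by blast
    have "diff_map ?P (Suc i) (join (?r (Suc (Suc i))) w' (- z')) = join (?r (Suc i)) y z"
      unfolding d_join[OF w'(1)] w'(2)[symmetric]
      by (simp add: diff_map_uminus z'(2) join_def fun_eq_iff)
    moreover have "- z' \<in> free_module P (Suc i)" using z'(1) by (simp add: free_module_def)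
    ultimately show "w \<in> diff_map ?P (Suc i) ` free_module ?P (Suc (Suc i))"
      using free_join[of "- z'" "Suc i" w'] wj by (metis imageI)
  next
    fix w assume "w \<in> diff_map ?P (Suc i) ` free_module ?P (Suc (Suc i))"
    then obtain w' where w': "w' \<in> free_module ?P (Suc (Suc i))" "w = diff_map ?P (Suc i) w'" by blast
    define y z where "y = pr1 (?r (Suc (Suc i))) w'" and "z = pr2 (?r (Suc (Suc i))) w'"
    have y: "y \<in> free_module P (Suc (Suc i))" and z: "z \<in> free_module P (Suc i)"
      unfolding y_def z_def by (rule free_pr1, rule free_pr2[OF w'(1)])
    have w: "w = join (?r (Suc i)) (diff_map P (Suc i) y + smul (Var x) z) (- diff_map P i z)"
      unfolding w'(2) diff_map_cone y_def z_def by simp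
    have "diff_map P (Suc i) y + smul (Var x) z \<in> free_module P (Suc i)"
      using dfree[of P "Suc i" y] z by (simp add: free_module_def)
    note d = d_join[OF this, of "- diff_map P i z", folded w]
    have 1: "diff_map P i (diff_map P (Suc i) y + smul (Var x) z) + smul (Var x) (- diff_map P i z) = 0"
      unfolding diff_map_add diff_map_smul dd[OF y] by (simp add: fun_eq_iff)
    have 2: "(case i of 0 \<Rightarrow> 0 | Suc k \<Rightarrow> - diff_map P k (- diff_map P i z)) = 0"
      using dd z by (cases i) (simp_all add: diff_map_uminus)
    have "diff_map ?P i w = 0"
      unfolding d 1 2 by (simp add: join_def fun_eq_iff)
    then show "w \<in> {w \<in> free_module ?P (Suc i). diff_map ?P i w = 0}"
      using dfree w'(2) by blast
  qed
  moreover have "res_rank ?P 0 = 1" "res_shift ?P 0 0 = 0" "res_aug ?P 0 = 1"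
    using rank0 by (simp_all add: cone_def)
  ultimately show ?thesis unfolding partial_koszul_def by blast
qed

lemma exists_partial_koszul:
  "finite S \<Longrightarrow> \<exists>P :: ('v, 'k::field) free_complex. partial_koszul S P"
  by (induction S rule: finite_induct) (blast intro: partial_koszul_empty partial_koszul_cone)+

text \<open>This gives meaning to the choice in \<open>residue_field_resolution\<close>. With all
  variables adjoined, the image of the first differential is the set of elements without constant
  term, the kernel of the augmentation.\<close>

lemma exists_graded_free_resolution:
  "\<exists>P :: ('v::finite, 'k::field) free_complex. graded_free_resolution P"
proof -
  obtain P :: "('v, 'k) free_complex" where P: "partial_koszul UNIV P"
    using exists_partial_koszul[of "UNIV :: 'v set"] by auto
  have rank0: "res_rank P 0 = 1" "res_shift P 0 0 = 0" "res_aug P 0 = 1"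
    and hom: "\<forall>i. \<forall>a<res_rank P i. \<forall>b<res_rank P (Suc i).
        res_diff P i a b \<in> graded_piece (res_shift P (Suc i) b - res_shift P i a)"
    and im: "diff_map P 0 ` free_module P 1 =
       {w \<in> free_module P 0. \<forall>m\<in>Poly_Mapping.keys (w 0). \<exists>t. Poly_Mapping.lookup m t > 0}"
    and ex: "\<forall>i. {w \<in> free_module P (Suc i). diff_map P i w = 0}
            = diff_map P (Suc i) ` free_module P (Suc (Suc i))"
    using P by (auto simp: partial_koszul_def)
  have aug: "aug_map P w = Poly_Mapping.lookup (w 0) 0" for w
    by (simp add: aug_map_def rank0)
  have "c \<in> aug_map P ` free_module P 0" for c
    by (rule image_eqI[of _ _ "\<lambda>a. if a = 0 then Poly_Mapping.single 0 c else 0"])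
      (auto simp: aug free_module_def rank0)
  then have surj: "aug_map P ` free_module P 0 = UNIV" by blast
  have "(\<exists>t. Poly_Mapping.lookup m t > 0) \<longleftrightarrow> m \<noteq> 0" for m :: "'v \<Rightarrow>\<^sub>0 nat"
    by (auto simp: poly_mapping_eq_iff fun_eq_iff)
  then have "(\<forall>m\<in>Poly_Mapping.keys (w 0). \<exists>t. Poly_Mapping.lookup m t > 0) \<longleftrightarrow> aug_map P w = 0" for w
    by (auto simp: aug in_keys_iff)
  with im have "{w \<in> free_module P 0. aug_map P w = 0} = diff_map P 0 ` free_module P 1"
    by simp
  with hom ex surj have "graded_free_resolution P"
    unfolding graded_free_resolution_def using rank0 by auto
  then show ?thesis ..
qed

interpretation residue_field: resolution "residue_field_resolution :: ('v::finite, 'k::field) free_complex"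
  by unfold_locales
    (simp add: residue_field_resolution_def someI_ex[OF exists_graded_free_resolution])

section \<open>Splitting of Tor\<close>

interpretation kvp: vector_space_pair "kscale :: 'k::field \<Rightarrow> (nat \<Rightarrow> ('v, 'k) mpoly) \<Rightarrow> _" kscale
  by unfold_locales

context resolution
begin

lemma cycles_subset: "tor_cycles P L i j \<subseteq> tor_chains P L i j"
  by (auto simp: tor_cycles_def)

lemma boundaries_subset_cycles:
  assumes "ideal.subspace L"
  shows "tor_boundaries P L i j \<subseteq> tor_cycles P L i j"
proof
  fix w assume "w \<in> tor_boundaries P L i j"
  then obtain y where y: "y \<in> tor_chains P L (Suc i) j" "w = diff_map P i y"
    by (auto simp: tor_boundaries_def)
  then have "w \<in> tor_chains P L i j" using diff_map_chain[OF assms] by blast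
  moreover have "i = 0 \<or> diff_map P (i - 1) w = 0"
    using y diff_diff[of y "i - 1"] by (cases i) (auto simp: tor_chains_def)
  ultimately show "w \<in> tor_cycles P L i j" by (simp add: tor_cycles_def)
qed

lemma boundaries_subspace:
  "ideal.subspace L \<Longrightarrow> kv.subspace (tor_boundaries P L i j)"
  unfolding tor_boundaries_def
  by (intro kvp.linear_subspace_image linear_diff_map tor_chains_subspace)

lemma cycles_subspace:
  assumes "ideal.subspace L"
  shows "kv.subspace (tor_cycles P L i j)"
proof (cases i)
  case 0
  then show ?thesis using tor_chains_subspace[OF assms] by (simp add: tor_cycles_def)
next
  case (Suc k)
  have "tor_cycles P L i j = tor_chains P L i j \<inter> {w. diff_map P k w = 0}"
    by (auto simp: tor_cycles_def Suc)
  then show ?thesis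
    by (simp only: kv.subspace_inter tor_chains_subspace[OF assms]
        kvp.linear_subspace_kernel[OF linear_diff_map])
qed

lemma dim_chains_Suc:
  assumes "ideal.subspace L"
  shows "kv.dim (tor_chains P L (Suc i) j) =
    kv.dim (tor_cycles P L (Suc i) j) + kv.dim (tor_boundaries P L i j)"
proof -
  obtain W where W: "finite W" "\<And>L. tor_chains P L (Suc i) j \<subseteq> kv.span W"
    using tor_chains_finite_span[of P "Suc i" j] by blast
  show ?thesis
    using kv.rank_nullity_on[OF linear_diff_map[of P i] tor_chains_subspace[OF assms] W(2) W(1)]
    by (simp add: tor_cycles_def tor_boundaries_def)
qed

text \<open>Ensures that the subtraction of naturals in \<open>tor_dim\<close> is never
  truncated.\<close>

lemma dim_boundaries_le:
  assumes "ideal.subspace L"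
  shows "kv.dim (tor_boundaries P L i j) \<le> kv.dim (tor_cycles P L i j)"
proof -
  obtain W where W: "finite W" "\<And>L. tor_chains P L i j \<subseteq> kv.span W"
    using tor_chains_finite_span[of P i j] by blast
  show ?thesis
    by (rule kv.dim_subset_finite[OF boundaries_subset_cycles[OF assms] _ W(1)])
      (use cycles_subset W(2) in blast)
qed

text \<open>The entries are split arbitrarily into parts from \<open>J\<close> and \<open>K\<close>,
  and passing to components makes the parts homogeneous.\<close>

lemma tor_chains_sum:
  assumes J: "hom_closed J" and K: "hom_closed K"
  shows "tor_chains P (ideal_sum J K) i j =
    {x + y | x y. x \<in> tor_chains P J i j \<and> y \<in> tor_chains P K i j}" (is "?lhs = ?rhs")
proof
  show "?lhs \<subseteq> ?rhs"
  proof
    fix w assume w: "w \<in> ?lhs"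
    have "\<exists>p q. p \<in> J \<and> q \<in> K \<and> w a = p + q" for a
    proof (cases "a < res_rank P i")
      case True
      with w have "w a \<in> ideal_sum J K" by (simp add: tor_chains_def)
      then show ?thesis unfolding ideal_sum_def by blast
    next
      case False
      with w have "w a = 0 + 0" by (auto simp: tor_chains_def free_module_def)
      then show ?thesis using J K by (blast dest: hom_closedD intro: ideal.subspace_0)
    qed
    then obtain p q where pq: "\<And>a. p a \<in> J" "\<And>a. q a \<in> K" "\<And>a. w a = p a + q a" by metis
    define p' where "p' = (\<lambda>a. if a < res_rank P i then p a else 0)"
    define q' where "q' = (\<lambda>a. if a < res_rank P i then q a else 0)"
    have "w a = p' a + q' a" for a
      using pq(3)[of a] w by (auto simp: p'_def q'_def tor_chains_def free_module_def)
    then have "hcomp P i j w = hcomp P i j p' + hcomp P i j q'"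
      by (simp add: hcomp_def fun_eq_iff restr_add)
    then have "w = hcomp P i j p' + hcomp P i j q'" using hcomp_id[OF w] by simp
    moreover have "hcomp P i j p' \<in> tor_chains P J i j" "hcomp P i j q' \<in> tor_chains P K i j"
      using pq by (auto intro!: hcomp_chain J K simp: p'_def q'_def free_module_def)
    ultimately show "w \<in> ?rhs" by blast
  qed
  show "?rhs \<subseteq> ?lhs"
  proof clarify
    fix x y assume "x \<in> tor_chains P J i j" "y \<in> tor_chains P K i j"
    moreover have "x a + y a \<in> ideal_sum J K" if "x a \<in> J" "y a \<in> K" for a
      using that unfolding ideal_sum_def by blast
    ultimately show "x + y \<in> tor_chains P (ideal_sum J K) i j"
      by (auto simp: tor_chains_def free_module_def graded_piece_add)
  qed
qed

text \<open>The hypotheses \<open>zJ\<close> and \<open>zK\<close> say that the maps from Tor of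
  \<open>J \<inter> K\<close> to Tor of \<open>J\<close> and of \<open>K\<close> vanish. In place of
  the long exact sequence, dimensions of chains (\<open>c\<close>) and of boundaries
  (\<open>b\<close>) are added up and linked by rank-nullity for the differential.\<close>

theorem tor_dim_splitting:
  assumes J: "hom_closed J" and K: "hom_closed K" and I: "ideal.subspace (ideal_sum J K)"
    and zJ: "\<And>i. tor_cycles P (J \<inter> K) i j \<subseteq> tor_boundaries P J i j"
    and zK: "\<And>i. tor_cycles P (J \<inter> K) i j \<subseteq> tor_boundaries P K i j"
  shows "tor_dim P (ideal_sum J K) i j =
    tor_dim P J i j + tor_dim P K i j + (if i = 0 then 0 else tor_dim P (J \<inter> K) (i - 1) j)"
proof -
  let ?I = "ideal_sum J K" and ?N = "J \<inter> K"
  note sub = hom_closedD[OF J] hom_closedD[OF K] I ideal.subspace_inter[OF hom_closedD[OF J] hom_closedD[OF K]]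
  have c: "kv.dim (tor_chains P ?I i j) + kv.dim (tor_chains P ?N i j) =
      kv.dim (tor_chains P J i j) + kv.dim (tor_chains P K i j)" for i
  proof -
    obtain W where W: "finite W" "\<And>L. tor_chains P L i j \<subseteq> kv.span W"
      using tor_chains_finite_span[of P i j] by blast
    have "tor_chains P J i j \<inter> tor_chains P K i j = tor_chains P ?N i j"
      by (auto simp: tor_chains_def)
    then show ?thesis
      using kv.dim_sum_inter[OF tor_chains_subspace[OF sub(1)] W(2) tor_chains_subspace[OF sub(2)] W(2) W(1)]
      by (simp add: tor_chains_sum[OF J K])
  qed
  have b: "kv.dim (tor_boundaries P ?I i j) + kv.dim (tor_cycles P ?N i j) =
      kv.dim (tor_boundaries P J i j) + kv.dim (tor_boundaries P K i j)" for i
  proof -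
    obtain W where W: "finite W" "\<And>L. tor_chains P L i j \<subseteq> kv.span W"
      using tor_chains_finite_span[of P i j] by blast
    have bW: "tor_boundaries P L i j \<subseteq> kv.span W" if "ideal.subspace L" for L
      using boundaries_subset_cycles[OF that] cycles_subset W(2) by blast
    \<comment> \<open>A common boundary is a cycle with entries in both ideals; the converse is the
      vanishing hypothesis.\<close>
    have 1: "tor_boundaries P J i j \<inter> tor_boundaries P K i j = tor_cycles P ?N i j"
    proof
      show "tor_boundaries P J i j \<inter> tor_boundaries P K i j \<subseteq> tor_cycles P ?N i j"
      proof
        fix w assume "w \<in> tor_boundaries P J i j \<inter> tor_boundaries P K i j"
        with boundaries_subset_cycles[OF sub(1)] boundaries_subset_cycles[OF sub(2)]
        have "w \<in> tor_cycles P J i j" "w \<in> tor_cycles P K i j" by blast+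
        then show "w \<in> tor_cycles P ?N i j" by (auto simp: tor_cycles_def tor_chains_def)
      qed
    qed (use zJ zK in blast)
    have 2: "tor_boundaries P ?I i j =
        {x + y | x y. x \<in> tor_boundaries P J i j \<and> y \<in> tor_boundaries P K i j}"
    proof
      show "tor_boundaries P ?I i j \<subseteq> {x + y | x y. x \<in> tor_boundaries P J i j \<and> y \<in> tor_boundaries P K i j}"
        unfolding tor_boundaries_def tor_chains_sum[OF J K] using diff_map_add by blast
      show "{x + y | x y. x \<in> tor_boundaries P J i j \<and> y \<in> tor_boundaries P K i j} \<subseteq> tor_boundaries P ?I i j"
      proof clarify
        fix x y assume "x \<in> tor_boundaries P J i j" "y \<in> tor_boundaries P K i j"
        then obtain x' y' where "x' \<in> tor_chains P J (Suc i) j" "y' \<in> tor_chains P K (Suc i) j"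
          and xy: "x = diff_map P i x'" "y = diff_map P i y'"
          unfolding tor_boundaries_def by blast
        then have "x' + y' \<in> tor_chains P ?I (Suc i) j"
          unfolding tor_chains_sum[OF J K] by blast
        then show "x + y \<in> tor_boundaries P ?I i j"
          unfolding xy diff_map_add[symmetric] tor_boundaries_def by (rule imageI)
      qed
    qed
    show ?thesis
      using kv.dim_sum_inter[OF boundaries_subspace[OF sub(1)] bW[OF sub(1)]
          boundaries_subspace[OF sub(2)] bW[OF sub(2)] W(1)]
      unfolding 1 2 .
  qed
  note le = dim_boundaries_le[OF sub(1), of i j] dim_boundaries_le[OF sub(2), of i j]
    dim_boundaries_le[OF sub(3), of i j]
  show ?thesis
  proof (cases i)
    case 0
    then have "tor_cycles P L i j = tor_chains P L i j" for L by (simp add: tor_cycles_def)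
    then show ?thesis using 0 c[of i] b[of i] le by (simp add: tor_dim_def)
  next
    case (Suc k)
    show ?thesis
      using c[of i] b[of i] b[of k] le dim_boundaries_le[OF sub(4), of k j]
        dim_chains_Suc[OF sub(1), of k j] dim_chains_Suc[OF sub(2), of k j]
        dim_chains_Suc[OF sub(3), of k j] dim_chains_Suc[OF sub(4), of k j]
      by (simp add: tor_dim_def Suc)
  qed
qed

section \<open>Scaling an ideal by a homogeneous regular element\<close>

lemma hcomp_smul:
  assumes "f \<in> graded_piece e"
  shows "hcomp P i j (smul f w) = smul f (hcomp P i (j - e) w)"
proof
  fix a
  have "j - res_shift P i a - e = j - e - res_shift P i a" by simp
  with restr_graded_piece_mult[OF assms, of "j - res_shift P i a" "w a"]
  show "hcomp P i j (smul f w) a = smul f (hcomp P i (j - e) w) a"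
    by (simp only: hcomp_def smul_apply)
qed

lemma smul_free_module: "w \<in> free_module P i \<Longrightarrow> smul f w \<in> free_module P i"
  by (simp add: free_module_def)

lemma tor_chains_scaled:
  assumes L: "hom_closed L" and f: "f \<in> graded_piece e"
  shows "tor_chains P ((*) f ` L) i j = smul f ` tor_chains P L i (j - e)"
proof
  show "tor_chains P ((*) f ` L) i j \<subseteq> smul f ` tor_chains P L i (j - e)"
  proof
    fix w assume w: "w \<in> tor_chains P ((*) f ` L) i j"
    have "\<exists>p\<in>L. (a < res_rank P i \<longrightarrow> w a = f * p)" for a
      using w ideal.subspace_0[OF hom_closedD[OF L]] by (cases "a < res_rank P i") (auto simp: tor_chains_def)
    then obtain p where p: "\<And>a. p a \<in> L" "\<And>a. a < res_rank P i \<Longrightarrow> w a = f * p a" by metis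
    define p' where "p' = (\<lambda>a. if a < res_rank P i then p a else 0)"
    have "w = smul f p'"
      using w p(2) by (auto simp: p'_def tor_chains_def free_module_def fun_eq_iff)
    then have "w = smul f (hcomp P i (j - e) p')"
      using hcomp_id[OF w] hcomp_smul[OF f] by metis
    moreover have "hcomp P i (j - e) p' \<in> tor_chains P L i (j - e)"
      using p(1) by (auto intro!: hcomp_chain L simp: p'_def free_module_def)
    ultimately show "w \<in> smul f ` tor_chains P L i (j - e)" by blast
  qed
  show "smul f ` tor_chains P L i (j - e) \<subseteq> tor_chains P ((*) f ` L) i j"
  proof safe
    fix w assume w: "w \<in> tor_chains P L i (j - e)"
    have "f * w a \<in> graded_piece (j - res_shift P i a)" if "a < res_rank P i" for a
      using graded_piece_mult[OF f, of "w a" "j - e - res_shift P i a"] w that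
      by (simp add: tor_chains_def algebra_simps)
    with w show "smul f w \<in> tor_chains P ((*) f ` L) i j"
      by (auto simp: tor_chains_def free_module_def)
  qed
qed

context
  fixes f :: "('v, 'k) mpoly" and e :: int
  assumes f: "f \<in> graded_piece e" and regular: "\<And>p. f * p = 0 \<Longrightarrow> p = 0"
begin

lemma smul_eq_0: "smul f w = 0 \<longleftrightarrow> w = 0"
  using regular by (auto simp: fun_eq_iff)

lemma tor_cycles_scaled:
  assumes L: "hom_closed L"
  shows "tor_cycles P ((*) f ` L) i j = smul f ` tor_cycles P L i (j - e)"
proof -
  have "diff_map P (i - 1) (smul f w) = 0 \<longleftrightarrow> diff_map P (i - 1) w = 0" for w
    by (simp only: diff_map_smul smul_eq_0)
  then show ?thesis
    unfolding tor_cycles_def tor_chains_scaled[OF L f] by blast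
qed

lemma tor_boundaries_scaled:
  assumes L: "hom_closed L"
  shows "tor_boundaries P ((*) f ` L) i j = smul f ` tor_boundaries P L i (j - e)"
  unfolding tor_boundaries_def tor_chains_scaled[OF L f] image_image by (simp only: diff_map_smul)

text \<open>Multiplication by the regular element \<open>f\<close> is an isomorphism of
  \<open>L\<close>, shifted by \<open>e\<close>, onto the scaled ideal, and it commutes with the
  differentials.\<close>

lemma tor_dim_scaled:
  assumes L: "hom_closed L"
  shows "tor_dim P ((*) f ` L) i j = tor_dim P L i (j - e)"
proof -
  obtain W where W: "finite W" "\<And>L. tor_chains P L i (j - e) \<subseteq> kv.span W"
    using tor_chains_finite_span[of P i "j - e"] by blast
  have sub: "ideal.subspace L" using L by (rule hom_closedD)
  have dim: "kv.dim (smul f ` S) = kv.dim S" if "kv.subspace S" "S \<subseteq> kv.span W" for S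
    using smul_eq_0 by (intro kv.dim_image_inj[OF linear_smul that W(1)]) blast
  have "tor_cycles P L i (j - e) \<subseteq> kv.span W" "tor_boundaries P L i (j - e) \<subseteq> kv.span W"
    using boundaries_subset_cycles[OF sub] cycles_subset W(2) by blast+
  then show ?thesis
    unfolding tor_dim_def tor_cycles_scaled[OF L] tor_boundaries_scaled[OF L]
    by (simp add: dim cycles_subspace[OF sub] boundaries_subspace[OF sub])
qed

end

lemma tor_dim_UNIV:
  assumes "i > 0"
  shows "tor_dim P UNIV i j = 0"
proof -
  have "tor_cycles P UNIV i j = tor_boundaries P UNIV i j"
    using cycles_UNIV_boundary[of _ i j] boundaries_subset_cycles[OF hom_closedD[OF hom_closed_UNIV]] assms
    by blast
  then show ?thesis by (simp add: tor_dim_def)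
qed

end

section \<open>Betti numbers of binomial edge ideals\<close>

lemma hom_closed_binomial_edge_ideal: "hom_closed (binomial_edge_ideal E :: ('n::finite + 'n, 'k::field) mpoly set)"
  unfolding binomial_edge_ideal_def
  by (rule hom_closed_ideal_gen) (use graded_piece_edge_binomial in \<open>auto simp: homogeneous_def\<close>)

lemma lookup_0_binomial_edge_ideal:
  assumes "p \<in> (binomial_edge_ideal E :: ('n + 'n, 'k::field) mpoly set)"
  shows "Poly_Mapping.lookup p 0 = 0"
proof -
  let ?Q = "{p :: ('n + 'n, 'k) mpoly. \<forall>m n. m + n = 0 \<longrightarrow> Poly_Mapping.lookup p m = 0}"
  have "binomial_edge_ideal E \<subseteq> ?Q"
  proof (rule binomial_edge_ideal_minimal[OF _ no_divisor_subspace], intro CollectI allI impI, rule ccontr)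
    fix i j and m n :: "'n + 'n \<Rightarrow>\<^sub>0 nat"
    assume m: "m + n = 0" "Poly_Mapping.lookup (edge_binomial i j :: ('n + 'n, 'k) mpoly) m \<noteq> 0"
    then have "m = xy i j \<or> m = xy j i"
      using keys_edge_binomial[of i j, where ?'k = 'k] by (auto simp: in_keys_iff)
    moreover have "Poly_Mapping.lookup m (Inl a) = 0" for a
      using arg_cong[OF m(1), of "\<lambda>m. Poly_Mapping.lookup m (Inl a)"] by (simp add: lookup_add)
    then have "Poly_Mapping.lookup m (Inl i) = 0" "Poly_Mapping.lookup m (Inl j) = 0" by auto
    ultimately show False by (auto simp: lookup_add)
  qed
  with assms show ?thesis by fastforce
qed

locale cut_edge_resolution =
  separated_simplicial E u v C + resolution P
  for E :: "'n::finite set set" and u v :: 'n and C :: "'n set"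
    and P :: "('n + 'n, 'k::field) free_complex"
begin

abbreviation "f \<equiv> edge_binomial u v :: ('n + 'n, 'k) mpoly"
abbreviation "J \<equiv> binomial_edge_ideal E :: ('n + 'n, 'k) mpoly set"
abbreviation "H \<equiv> binomial_edge_ideal (edge_completion E u v) :: ('n + 'n, 'k) mpoly set"

lemma f_regular: "f * p = 0 \<Longrightarrow> p = 0"
  using neq by simp

lemma principal: "ideal_gen {f} = (*) f ` UNIV"
  by (auto simp: ideal_gen_singleton mult.commute)

lemma inter_cycles: "tor_cycles P (J \<inter> ideal_gen {f}) i j = smul f ` tor_cycles P H i (j - 2)"
  unfolding inter_principal
  by (rule tor_cycles_scaled[OF graded_piece_edge_binomial f_regular hom_closed_binomial_edge_ideal])

text \<open>
  On the ideal \<open>H\<close>, multiplication by \<open>x\<^sub>u\<close> and by \<open>y\<^sub>u\<close> takes values in \<open>J\<close>. So multiplication by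
  \<open>f = y\<^sub>v x\<^sub>u - x\<^sub>v y\<^sub>u\<close>, as a map from \<open>H\<close> to \<open>J\<close>, factors through multiplication by variables on \<open>J\<close>.
\<close>

lemma inter_cycles_boundary:
  "tor_cycles P (J \<inter> ideal_gen {f}) i j \<subseteq> tor_boundaries P J i j"
proof
  fix w assume "w \<in> tor_cycles P (J \<inter> ideal_gen {f}) i j"
  then obtain w' where w': "w' \<in> tor_cycles P H i (j - 2)" and w: "w = smul f w'"
    unfolding inter_cycles by blast
  have 1: "smul (Var t) w' \<in> tor_cycles P J i (j - 1)" if t: "t \<in> {Inl u, Inr u}" for t
  proof -
    have chain: "w' a \<in> H" "w' a \<in> graded_piece (j - 2 - res_shift P i a)" if "a < res_rank P i" for a
      using w' that by (auto simp: tor_cycles_def tor_chains_def)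
    have free: "w' \<in> free_module P i" using w' by (auto simp: tor_cycles_def tor_chains_def)
    have "Var t * w' a \<in> J \<inter> graded_piece (j - 1 - res_shift P i a)" if "a < res_rank P i" for a
      using edge_completion_binomial_Var_mem[OF simplicial t chain(1)[OF that]]
        graded_piece_mult[OF graded_piece_Var chain(2)[OF that], of t]
      by (simp add: algebra_simps)
    then have "smul (Var t) w' \<in> tor_chains P J i (j - 1)"
      using free by (simp add: tor_chains_def smul_free_module)
    moreover have "i = 0 \<or> diff_map P (i - 1) (smul (Var t) w') = 0"
      using w' unfolding diff_map_smul by (auto simp: tor_cycles_def fun_eq_iff)
    ultimately show ?thesis by (simp add: tor_cycles_def)
  qed
  have 2: "smul (Var s) (smul (Var t) w') \<in> tor_boundaries P J i j" if "t \<in> {Inl u, Inr u}" for s t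
    by (rule Var_smul_boundary[OF hom_closed_binomial_edge_ideal 1[OF that]])
  have "w = smul (Var (Inr v)) (smul (Var (Inl u)) w') - smul (Var (Inl v)) (smul (Var (Inr u)) w')"
    unfolding w by (simp add: fun_eq_iff edge_binomial_def algebra_simps)
  also have "\<dots> \<in> tor_boundaries P J i j"
    by (rule kv.subspace_diff[OF boundaries_subspace[OF binomial_edge_ideal_subspace] 2 2]) simp_all
  finally show "w \<in> tor_boundaries P J i j" .
qed

text \<open>Dividing by \<open>f\<close> turns the claim into one about cycles with entries in
  \<open>H\<close>: they bound over the whole ring by exactness, and at \<open>i = 0\<close> the
  augmentation vanishes since \<open>H\<close> has no constant terms.\<close>

lemma inter_cycles_boundary_principal:
  "tor_cycles P (J \<inter> ideal_gen {f}) i j \<subseteq> tor_boundaries P (ideal_gen {f}) i j"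
proof -
  have "tor_cycles P H i (j - 2) \<subseteq> tor_boundaries P UNIV i (j - 2)"
  proof
    fix w assume w: "w \<in> tor_cycles P H i (j - 2)"
    show "w \<in> tor_boundaries P UNIV i (j - 2)"
    proof (rule cycles_UNIV_boundary)
      show "w \<in> tor_cycles P UNIV i (j - 2)"
        using w by (auto simp: tor_cycles_def tor_chains_def)
      assume "i = 0"
      with w have "w a \<in> H" if "a < res_rank P 0" for a
        using that by (auto simp: tor_cycles_def tor_chains_def)
      then show "aug_map P w = 0"
        unfolding aug_map_def by (intro sum.neutral) (auto intro: lookup_0_binomial_edge_ideal)
    qed
  qed
  moreover have "tor_boundaries P (ideal_gen {f}) i j = smul f ` tor_boundaries P UNIV i (j - 2)"
    unfolding principal
    by (rule tor_boundaries_scaled[OF graded_piece_edge_binomial f_regular hom_closed_UNIV])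
  ultimately show ?thesis
    unfolding inter_cycles by blast
qed

lemma hom_closed_principal: "hom_closed (ideal_gen {f})"
  by (rule hom_closed_ideal_gen) (use graded_piece_edge_binomial in \<open>auto simp: homogeneous_def\<close>)

lemma tor_dim_sum:
  assumes "ideal.subspace (ideal_sum J (ideal_gen {f}))"
  shows "tor_dim P (ideal_sum J (ideal_gen {f})) i j =
    tor_dim P J i j + tor_dim P (ideal_gen {f}) i j +
    (if i = 0 then 0 else tor_dim P (J \<inter> ideal_gen {f}) (i - 1) j)"
  by (rule tor_dim_splitting[OF hom_closed_binomial_edge_ideal hom_closed_principal assms
        inter_cycles_boundary inter_cycles_boundary_principal])

lemma tor_dim_inter: "tor_dim P (J \<inter> ideal_gen {f}) i j = tor_dim P H i (j - 2)"
  unfolding inter_principal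
  by (rule tor_dim_scaled[OF graded_piece_edge_binomial f_regular hom_closed_binomial_edge_ideal])

text \<open>The principal ideal is free of rank one, so its higher Tor vanishes.\<close>

lemma tor_dim_principal:
  assumes "i > 0"
  shows "tor_dim P (ideal_gen {f}) i j = 0"
proof -
  have "tor_dim P (ideal_gen {f}) i j = tor_dim P UNIV i (j - 2)"
    unfolding principal
    by (rule tor_dim_scaled[OF graded_piece_edge_binomial f_regular hom_closed_UNIV])
  then show ?thesis using tor_dim_UNIV[OF assms] by simp
qed

end

lemma ideal_sum_ideal_gen: "ideal_sum (ideal_gen A) (ideal_gen B) = ideal_gen (A \<union> B)"
  by (auto simp: ideal_sum_def ideal_gen_def ideal.span_Un)

lemma binomial_edge_ideal_delete_edge:
  assumes "{u, v} \<in> E"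
  shows "binomial_edge_ideal E = ideal_sum (binomial_edge_ideal (delete_edge E {u, v})) (ideal_gen {edge_binomial u v})"
proof -
  let ?G = "{edge_binomial i j | i j. {i, j} \<in> delete_edge E {u, v}}" and ?f = "edge_binomial u v"
  have "binomial_edge_ideal E = ideal_gen (?G \<union> {?f})"
  proof
    show "binomial_edge_ideal E \<subseteq> ideal_gen (?G \<union> {?f})"
    proof (rule binomial_edge_ideal_minimal)
      fix i j assume "{i, j} \<in> E"
      have f: "?f \<in> ideal_gen (?G \<union> {?f})" by (rule ideal_gen_base) simp
      show "edge_binomial i j \<in> ideal_gen (?G \<union> {?f})"
      proof (cases "{i, j} = {u, v}")
        case True
        with f ideal.subspace_neg[OF ideal_gen_subspace f] show ?thesis
          by (auto simp: doubleton_eq_iff edge_binomial_swap[of u v])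
      next
        case False
        with \<open>{i, j} \<in> E\<close> show ?thesis by (intro ideal_gen_base) (auto simp: delete_edge_def)
      qed
    qed simp
    show "ideal_gen (?G \<union> {?f}) \<subseteq> binomial_edge_ideal E"
      by (rule ideal_gen_minimal) (auto simp: delete_edge_def assms intro!: edge_binomial_mem)
  qed
  then show ?thesis
    by (simp only: ideal_sum_ideal_gen binomial_edge_ideal_def[of "delete_edge E {u, v}"])
qed

theorem theorem4p3:
  fixes E :: "'n::finite set set" and u v :: 'n
  assumes "simple_graph E"
    and "{u, v} \<in> E"
    and "cut_edge E {u, v}"
    and "free_vertex (delete_edge E {u, v}) v"
  shows "complete_betti_splitting
           (binomial_edge_ideal E :: ('n + 'n, 'k::field) mpoly set)
           (binomial_edge_ideal (delete_edge E {u, v}))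
           (ideal_gen {edge_binomial u v})
       \<and> (\<forall>i j :: int. i \<ge> 1 \<longrightarrow> j \<ge> 0 \<longrightarrow>
           betti i j (binomial_edge_ideal E :: ('n + 'n, 'k) mpoly set) =
           betti i j (binomial_edge_ideal (delete_edge E {u, v}) :: ('n + 'n, 'k) mpoly set) +
           betti (i - 1) (j - 2)
             (binomial_edge_ideal (edge_completion (delete_edge E {u, v}) u v)
               :: ('n + 'n, 'k) mpoly set))"
proof -
  let ?E = "delete_edge E {u, v}"
  let ?I = "binomial_edge_ideal E :: ('n + 'n, 'k) mpoly set"
  let ?J = "binomial_edge_ideal ?E :: ('n + 'n, 'k) mpoly set"
  let ?f = "edge_binomial u v :: ('n + 'n, 'k) mpoly"
  let ?K = "ideal_gen {?f}"
  obtain C where "separated_simplicial ?E u v C"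
    using separated_simplicial_cut_edge[OF assms(1,3,4)] by blast
  then interpret separated_simplicial ?E u v C .
  interpret cut_edge_resolution ?E u v C "residue_field_resolution :: ('n + 'n, 'k) free_complex" ..
  have sum: "?I = ideal_sum ?J ?K" by (rule binomial_edge_ideal_delete_edge[OF assms(2)])
  \<comment> \<open>At \<open>i = 0\<close> the last summand is \<open>betti (-1) j\<close>, which
    is 0 like the \<open>if\<close> in \<open>tor_dim_sum\<close>.\<close>
  have split: "betti i j ?I = betti i j ?J + betti i j ?K + betti (i - 1) j (?J \<inter> ?K)" if "i \<ge> 0" for i j
    using tor_dim_sum[of "nat i" j] that
    by (cases "i = 0") (auto simp: betti_def nat_diff_distrib simp flip: sum)
  have hom: "homogeneous_ideal (binomial_edge_ideal G :: ('n + 'n, 'k) mpoly set)" for G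
  proof -
    have "\<forall>s\<in>{edge_binomial i j | i j. {i, j} \<in> G}. homogeneous (s :: ('n + 'n, 'k) mpoly)"
      using graded_piece_edge_binomial by (auto simp: homogeneous_def)
    then show ?thesis unfolding homogeneous_ideal_def binomial_edge_ideal_def by blast
  qed
  have homK: "homogeneous_ideal ?K"
  proof -
    have "\<forall>s\<in>{?f}. homogeneous s"
      using graded_piece_edge_binomial by (auto simp: homogeneous_def)
    then show ?thesis unfolding homogeneous_ideal_def by blast
  qed
  have gens: "\<exists>A B. minimal_homogeneous_generators A ?J \<and> minimal_homogeneous_generators B ?K \<and>
      A \<inter> B = {} \<and> minimal_homogeneous_generators (A \<union> B) ?I"
  proof -
    \<comment> \<open>The edge \<open>{u, v}\<close> is oriented from \<open>u\<close> to
      \<open>v\<close>, so that its generator is \<open>f\<close> and not its negative.\<close>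
    have "\<exists>a b. {a, b} = e \<and> (e = {u, v} \<longrightarrow> a = u \<and> b = v)" if "e \<in> E" for e
    proof (cases "e = {u, v}")
      case False
      have "card e = 2" using that assms(1) by (simp add: simple_graph_def)
      with False show ?thesis by (auto simp: card_2_iff)
    qed blast
    then obtain a b where ab: "\<And>e. e \<in> E \<Longrightarrow> {a e, b e} = e" "a {u, v} = u" "b {u, v} = v"
      using assms(2) by metis
    let ?g = "\<lambda>e. edge_binomial (a e) (b e) :: ('n + 'n, 'k) mpoly"
    have E: "E = ?E \<union> {{u, v}}" using assms(2) by (auto simp: delete_edge_def)
    have "minimal_homogeneous_generators (?g ` ?E) ?J"
      by (rule minimal_generators_edge_binomials[OF simple]) (use ab(1) in \<open>simp add: delete_edge_def\<close>)
    moreover have "minimal_homogeneous_generators {?f} ?K"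
    proof -
      have "?f \<noteq> 0" using f_regular[of 1] by auto
      then have "ideal_gen B \<noteq> ?K" if "B \<subset> {?f}" for B
      proof -
        have "B = {}" using that by auto
        then show ?thesis using ideal_gen_base[of ?f "{?f}"] \<open>?f \<noteq> 0\<close> by (auto simp: ideal_gen_def)
      qed
      then show ?thesis
        using graded_piece_edge_binomial by (auto simp: minimal_homogeneous_generators_def homogeneous_def)
    qed
    moreover have "?g ` ?E \<inter> {?f} = {}"
    proof -
      \<comment> \<open>Otherwise 1 would lie in the colon ideal \<open>H\<close>, which has no
        constant terms.\<close>
      have notin: "?f \<notin> ?J"
      proof
        assume "?f \<in> ?J"
        then have "1 \<in> H" using mult_mem_iff[of "1 :: ('n + 'n, 'k) mpoly"] by simp
        from lookup_0_binomial_edge_ideal[OF this] show False by simp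
      qed
      have "?g ` ?E \<subseteq> ?J" using ab(1) by (auto simp: delete_edge_def intro!: edge_binomial_mem)
      from contra_subsetD[OF this notin] show ?thesis by simp
    qed
    moreover have "minimal_homogeneous_generators (?g ` ?E \<union> {?f}) ?I"
    proof -
      have "?g ` ?E \<union> {?f} = ?g ` E" by (subst (2) E) (simp add: ab)
      then show ?thesis using minimal_generators_edge_binomials[OF assms(1) ab(1)] by simp
    qed
    ultimately show ?thesis by blast
  qed
  have "complete_betti_splitting ?I ?J ?K"
    unfolding complete_betti_splitting_def using hom homK sum gens split by blast
  \<comment> \<open>For \<open>i \<ge> 1\<close> the summand of the principal ideal vanishes, and
    the intersection is \<open>H\<close> scaled by \<open>f\<close>, of degree 2.\<close>
  moreover have "betti i j ?I = betti i j ?J + betti (i - 1) (j - 2) H" if "i \<ge> 1" for i j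
    using split[of i j] that tor_dim_principal[of "nat i" j] tor_dim_inter[of "nat (i - 1)" j]
    by (simp add: betti_def)
  ultimately show ?thesis by blast
qed

end
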